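(* Let $q\in\mathbb{C}$ with $0<|q|<1$. For generic $z,u\in\mathbb{C}^*$ the following five identities hold: $$z\frac{\Theta(z^{2};q^3)\Theta(q^{3}z^{6};q^{9})}{\Theta(z;q^3)}+q\frac{\Theta(q^2z^{2};q^3)\Theta(z^{6};q^{9})}{\Theta(qz;q^3)}+z^{3}\frac{\Theta(qz^{2};q^3)\Theta(q^{6}z^{6};q^{9})}{\Theta(q^2z;q^3)}=\frac{z(q;q)_{\infty}(q^3;q^3)_{\infty}\Theta(z^3;q)}{\Theta(z;q)\Theta(q^2z^3;q^3)},$$ $$z^{4}\frac{\Theta(z^{2};q^3)\Theta(q^{6}z^{6};q^{9})}{\Theta(z;q^3)}+z^{3}\frac{\Theta(q^2z^{2};q^3)\Theta(q^{3}z^{6};q^{9})}{\Theta(qz;q^3)}-q\frac{\Theta(qz^{2};q^3)\Theta(z^{6};q^{9})}{\Theta(q^2z;q^3)}=\frac{z^3(q;q)_{\infty}(q^3;q^3)_{\infty}\Theta(z^{3};q)}{\Theta(z;q)\Theta(qz^3;q^3)},$$ $$\frac{\Theta(u^{4};q^3)\Theta(q^{3}u^{3};q^{9})}{\Theta(u^2;q^3)}+uq\frac{\Theta(q^2u^{4};q^3)\Theta(u^{3};q^{9})}{\Theta(qu^2;q^3)}+u\frac{\Theta(qu^{4};q^3)\Theta(q^{6}u^{3};q^{9})}{\Theta(q^2u^2;q^3)}=\frac{(q;q)_{\infty}(q^3;q^3)_{\infty}}{\Theta(u;q)\Theta(q^2u^3;q^3)}\cdot\Theta(u^{3};q),$$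 $$u^{2}\frac{\Theta(u^{4};q^3)\Theta(q^{6}u^{3};q^{9})}{\Theta(u^2;q^3)}+u^3\frac{\Theta(q^2u^{4};q^3)\Theta(q^{3}u^{3};q^{9})}{\Theta(qu^2;q^3)}-q\frac{\Theta(qu^{4};q^3)\Theta(u^{3};q^{9})}{\Theta(q^2u^2;q^3)}=\frac{u^2(q;q)_{\infty}(q^3;q^3)_{\infty}\Theta(u^{3};q)}{\Theta(u;q)\Theta(qu^3;q^3)},$$ $$q\frac{\Theta(q^3z^{2};q^6)\Theta(z^{6};q^{18})}{\Theta(z;q^6)}+z^3\frac{\Theta(qz^{2};q^6)\Theta(q^{12}z^{6};q^{18})}{\Theta(q^2z;q^6)}+z^2\frac{\Theta(q^5z^{2};q^6)\Theta(q^{6}z^{6};q^{18})}{\Theta(q^4z;q^6)}=z^2\frac{(q^2;q^2)_{\infty}^2\Theta(q^3;q^{18})\Theta(-z;q)}{(q;q)_{\infty}}\cdot\frac{\Theta(q^3z^{3};q^6)}{(q^6;q^6)_{\infty}^3}.$$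
   Context: $\mathbb{C}^*=\mathbb{C}\setminus\{0\}$. For $Q\in\mathbb{C}$ with $0<|Q|<1$ and $x\in\mathbb{C}$, $(x;Q)_\infty=\prod_{i\ge 0}(1-Q^i x)$. For $x\in\mathbb{C}^*$, $$\Theta(x;Q)=(x;Q)_\infty(Q/x;Q)_\infty(Q;Q)_\infty=\sum_{n=-\infty}^{\infty}(-1)^nQ^{\binom n2}x^n .$$ "Generic" means that no denominator in the identity under consideration vanishes. *)

theory Defs
  imports "HOL-Analysis.Analysis"
begin

definition qpoch_inf :: "complex \<Rightarrow> complex \<Rightarrow> complex" where
  "qpoch_inf x Q = (\<Prod>i. 1 - Q ^ i * x)"

text \<open>Used only for \<open>x \<noteq> 0\<close> and \<open>0 < norm Q < 1\<close>; there the product converges and,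
  by the Jacobi triple product identity, equals the bilateral series with terms
  \<open>(-1)^n Q^(n(n-1)/2) x^n\<close>.\<close>

definition Theta :: "complex \<Rightarrow> complex \<Rightarrow> complex" where
  "Theta x Q = qpoch_inf x Q * qpoch_inf (Q / x) Q * qpoch_inf Q Q"

end

theory Submission
  imports Defs "HOL-Complex_Analysis.Complex_Analysis"
begin

text \<open>
  All five identities are equalities of quasi-periodic functions. A function \<open>F\<close> that is holomorphic on
  the punctured plane and satisfies \<open>F (Q * x) = m x * F x\<close> is determined, up to a constant factor, by its
  multiplier \<open>m\<close> and its zeros: if \<open>G\<close> has the same multiplier, only simple zeros, and \<open>F\<close> vanishes at all
  of them, then \<open>F / G\<close> extends to a holomorphic function that is invariant under \<open>x \<mapsto> Q * x\<close>. Composed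
  with the exponential function it is entire and bounded, hence constant by Liouville's theorem. This is
  \<open>quasi_periodic_unique\<close>. To use it, one compares multipliers, checks finitely many zeros (one for each
  orbit under multiplication by \<open>Q\<close>), and evaluates both sides at a single further point. It is applied
  three times.

  First, it gives the quintuple product identity (\<open>quintuple_product\<close>), by which every quotient
  \<open>Theta (x^2) Q / Theta x Q\<close> is, up to a
  constant factor, a combination of two theta functions of nome \<open>Q^3\<close> in \<open>x^3\<close>. With \<open>Q = q^3\<close> this
  clears the denominators in the first four identities. The left-hand sides of the first and of the third
  one become the same bilinear form \<open>cubic_theta_form\<close> in thetas of \<open>u^3\<close> and of \<open>u^6\<close> with nome \<open>q^9\<close>,
  up to a constant factor and a factor \<open>z\<close>. The two identities differ only in which of the two families of thetas has been
  written as quotients.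

  Secondly, \<open>cubic_theta_form_product\<close> evaluates this form: multiplied by \<open>Theta u q\<close> and
  \<open>Theta (q^2 * u^3) (q^3)\<close> it vanishes wherever \<open>u^3\<close> is a power of \<open>q\<close>, so it is a multiple of
  \<open>Theta (u^3) q\<close>; the multiple is read off at \<open>u = -1\<close>. The second and the fourth identity are the first
  and the third one at \<open>1 / z\<close> and \<open>1 / u\<close>.

  Thirdly, \<open>sextic_theta_form_eq_product\<close> treats the fifth identity after multiplication by its three
  denominators. Both sides are quasi-periodic under \<open>z \<mapsto> q^2 * z\<close>, and the zeros of the right-hand side
  are the orbits of \<open>1\<close>, \<open>-1\<close>, \<open>-1 / q\<close> and \<open>v / q\<close> with \<open>v^3 = 1\<close>. The constant comes from
  \<open>z = r^(-3)\<close> with \<open>r^2 = q\<close>, where one of the three terms drops out and the quintuple product identity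
  adds up the other two.
\<close>

section \<open>The infinite q-Pochhammer symbol\<close>

lemma qpoch_inf_convergent:
  assumes "norm Q < 1"
  shows "convergent_prod (\<lambda>i. 1 - Q ^ i * x :: complex)"
proof -
  have "summable (\<lambda>i. norm (Q ^ i * x))"
    using assms by (simp add: norm_mult norm_power summable_mult2)
  hence "abs_convergent_prod (\<lambda>i. 1 - Q ^ i * x)"
    by (simp add: abs_convergent_prod_conv_summable)
  thus ?thesis by (rule abs_convergent_prod_imp_convergent_prod)
qed

lemma qpoch_inf_LIMSEQ:
  assumes "norm Q < 1"
  shows "(\<lambda>n. \<Prod>i<n. 1 - Q ^ i * x) \<longlonglongrightarrow> qpoch_inf x Q"
proof -
  have "(\<lambda>n. \<Prod>i\<le>n. 1 - Q ^ i * x) \<longlonglongrightarrow> qpoch_inf x Q"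
    unfolding qpoch_inf_def by (rule convergent_prod_LIMSEQ[OF qpoch_inf_convergent[OF assms]])
  thus ?thesis
    by (subst filterlim_sequentially_Suc[symmetric]) (simp add: lessThan_Suc_atMost)
qed

text \<open>
  A convergent infinite product vanishes only if one of its factors does.
\<close>
lemma qpoch_inf_eq_0_iff:
  assumes "norm Q < 1"
  shows "qpoch_inf x Q = 0 \<longleftrightarrow> (\<exists>i. Q ^ i * x = 1)"
  using has_prod_eq_0_iff[OF convergent_prod_has_prod[OF qpoch_inf_convergent[OF assms, of x]]]
  by (auto simp: qpoch_inf_def image_iff) 

lemma qpoch_inf_shift:
  assumes "norm Q < 1"
  shows "qpoch_inf x Q = (1 - x) * qpoch_inf (Q * x) Q"
proof -
  have "(\<lambda>n. \<Prod>i<Suc n. 1 - Q ^ i * x) \<longlonglongrightarrow> qpoch_inf x Q"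
    using qpoch_inf_LIMSEQ[OF assms, of x] by (subst filterlim_sequentially_Suc)
  moreover have "(\<lambda>n. \<Prod>i<Suc n. 1 - Q ^ i * x) = (\<lambda>n. (1 - x) * (\<Prod>i<n. 1 - Q ^ i * (Q * x)))"
    by (subst prod.lessThan_Suc_shift) (simp add: mult_ac)
  moreover have "\<dots> \<longlonglongrightarrow> (1 - x) * qpoch_inf (Q * x) Q"
    by (intro tendsto_mult_left qpoch_inf_LIMSEQ assms)
  ultimately show ?thesis using LIMSEQ_unique by metis
qed

lemma qpoch_inf_self_nonzero:
  assumes "norm Q < 1"
  shows "qpoch_inf Q Q \<noteq> 0"
proof
  assume "qpoch_inf Q Q = 0"
  then obtain i where "Q ^ i * Q = 1" by (auto simp: qpoch_inf_eq_0_iff[OF assms])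
  hence "norm Q ^ Suc i = 1" by (metis norm_one norm_power power_Suc2)
  thus False using assms power_Suc_less_one[of "norm Q" i]
    by (smt (verit) norm_ge_zero power_0_Suc)
qed

text \<open>
  The partial products converge uniformly on every disc, by the Weierstrass M-test with majorant
  \<open>norm Q ^ i * R\<close>.
\<close>
lemma qpoch_inf_holomorphic:
  assumes "norm Q < 1"
  shows "(\<lambda>x. qpoch_inf x Q) holomorphic_on A"
proof (rule holomorphic_on_subset)
  let ?P = "\<lambda>N x. \<Prod>i<N. 1 - Q ^ i * x"
  have lim: "uniform_limit (cball 0 R) ?P (\<lambda>x. qpoch_inf x Q) sequentially" for R
  proof -
    have "uniformly_convergent_on (cball 0 R) ?P"
    proof (rule uniformly_convergent_on_prod')
      show "uniformly_convergent_on (cball 0 R) (\<lambda>N x. \<Sum>i<N. norm ((1 - Q ^ i * x) - 1))"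
      proof (rule Weierstrass_m_test')
        show "norm (norm ((1 - Q ^ i * x) - 1)) \<le> norm Q ^ i * R" if "x \<in> cball 0 R" for i x
          using that by (auto simp: norm_mult norm_power intro!: mult_left_mono)
        show "summable (\<lambda>i. norm Q ^ i * R)"
          using assms by (intro summable_mult2 summable_geometric) auto
      qed
    qed (auto intro!: continuous_intros)
    then obtain g where g: "uniform_limit (cball 0 R) ?P g sequentially"
      by (auto simp: uniformly_convergent_on_def)
    moreover have "g x = qpoch_inf x Q" if "x \<in> cball 0 R" for x
      using tendsto_uniform_limitI[OF g that] qpoch_inf_LIMSEQ[OF assms] LIMSEQ_unique by blast
    ultimately show ?thesis
      using uniform_limit_cong'[of "cball 0 R" ?P ?P g "\<lambda>x. qpoch_inf x Q" sequentially] by auto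
  qed
  show "(\<lambda>x. qpoch_inf x Q) holomorphic_on UNIV"
  proof (rule holomorphic_uniform_sequence)
    fix z :: complex
    have "uniform_limit (cball z 1) ?P (\<lambda>x. qpoch_inf x Q) sequentially"
      using lim[of "norm z + 1"] by (rule uniform_limit_on_subset) (simp add: cball_subset_cball_iff)
    thus "\<exists>d>0. cball z d \<subseteq> UNIV \<and> uniform_limit (cball z d) ?P (\<lambda>x. qpoch_inf x Q) sequentially"
      by (intro exI[of _ 1]) auto
  qed (auto intro!: holomorphic_intros)
qed auto

text \<open>
  The factors are sorted by the residue of their exponent modulo \<open>k\<close>; already the partial products
  of length \<open>n * k\<close> agree.
\<close>
lemma qpoch_inf_split:
  assumes "norm Q < 1" "k > 0"
  shows "qpoch_inf x Q = (\<Prod>j<k. qpoch_inf (Q ^ j * x) (Q ^ k))"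
proof (rule LIMSEQ_unique)
  have "norm (Q ^ k) < 1"
    using assms by (metis norm_ge_zero norm_power power_less_one_iff)
  thus "(\<lambda>n. \<Prod>j<k. \<Prod>i<n. 1 - (Q ^ k) ^ i * (Q ^ j * x)) \<longlonglongrightarrow> (\<Prod>j<k. qpoch_inf (Q ^ j * x) (Q ^ k))"
    by (intro tendsto_prod qpoch_inf_LIMSEQ)
  have "(\<Prod>j<k. \<Prod>i<n. 1 - (Q ^ k) ^ i * (Q ^ j * x)) = (\<Prod>i<n * k. 1 - Q ^ i * x)" for n
  proof -
    have exponent: "(Q ^ k) ^ i * (Q ^ j * x) = Q ^ (j + k * i) * x" for i j
      by (simp add: power_add power_mult)
    have "(\<Prod>j<k. \<Prod>i<n. 1 - (Q ^ k) ^ i * (Q ^ j * x))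
        = (\<Prod>i<n. \<Prod>j<k. 1 - Q ^ (j + k * i) * x)"
      by (subst prod.swap) (simp add: exponent)
    also have "\<dots> = (\<Prod>i<n. \<Prod>j\<in>{i * k..<i * k + k}. 1 - Q ^ j * x)"
    proof (rule prod.cong[OF refl])
      fix i
      show "(\<Prod>j<k. 1 - Q ^ (j + k * i) * x) = (\<Prod>j\<in>{i * k..<i * k + k}. 1 - Q ^ j * x)"
        using prod.shift_bounds_nat_ivl[of "\<lambda>j. 1 - Q ^ j * x" 0 "k * i" k]
        by (simp add: atLeast0LessThan add.commute[of k] mult.commute[of i])
    qed
    also have "\<dots> = (\<Prod>i<n * k. 1 - Q ^ i * x)"
      by (rule prod.nat_group)
    finally show ?thesis .
  qed
  moreover have "(\<lambda>n. \<Prod>i<n * k. 1 - Q ^ i * x) \<longlonglongrightarrow> qpoch_inf x Q"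
    using filterlim_compose[OF qpoch_inf_LIMSEQ[OF assms(1)] mult_nat_right_at_top[OF assms(2)]] .
  ultimately show "(\<lambda>n. \<Prod>j<k. \<Prod>i<n. 1 - (Q ^ k) ^ i * (Q ^ j * x)) \<longlonglongrightarrow> qpoch_inf x Q"
    by simp
qed

lemma qpoch_inf_square:
  assumes "norm Q < 1"
  shows "qpoch_inf (x^2) (Q^2) = qpoch_inf x Q * qpoch_inf (- x) Q"
proof (rule LIMSEQ_unique)
  have "norm (Q ^ 2) < 1" using assms by (simp add: norm_power power_less_one_iff)
  thus "(\<lambda>n. \<Prod>i<n. 1 - (Q^2) ^ i * x^2) \<longlonglongrightarrow> qpoch_inf (x^2) (Q^2)" by (rule qpoch_inf_LIMSEQ)
  have "(\<Prod>i<n. 1 - (Q^2) ^ i * x^2) = (\<Prod>i<n. 1 - Q ^ i * x) * (\<Prod>i<n. 1 - Q ^ i * (- x))" for n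
    unfolding prod.distrib[symmetric]
    by (intro prod.cong refl) (simp add: power2_eq_square power_mult_distrib algebra_simps)
  thus "(\<lambda>n. \<Prod>i<n. 1 - (Q^2) ^ i * x^2) \<longlonglongrightarrow> qpoch_inf x Q * qpoch_inf (- x) Q"
    using tendsto_mult[OF qpoch_inf_LIMSEQ[OF assms, of x] qpoch_inf_LIMSEQ[OF assms, of "- x"]]
    by (simp only:)
qed

section \<open>Quasi-periodic holomorphic functions on the punctured plane\<close>

text \<open>
  Both vanishing and nondegeneracy of a zero are invariant under one step \<open>x \<mapsto> Q * x\<close>, and so is the
  value of a periodic function. This rule transports all of them along whole orbits.
\<close>
lemma orbit_invariant:
  fixes Q x :: complex
  assumes "Q \<noteq> 0" and step: "\<And>x. x \<noteq> 0 \<Longrightarrow> P (Q * x) = P x" and "x \<noteq> 0"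
  shows "P (Q powi n * x) = P x"
proof (induction n rule: int_induct[where k = 0])
  case base
  show ?case by simp
next
  case (step1 i)
  have "P (Q powi (i + 1) * x) = P (Q * (Q powi i * x))"
    using assms by (simp add: power_int_add mult_ac)
  thus ?case using step[of "Q powi i * x"] step1 assms by simp
next
  case (step2 i)
  have "P (Q * (Q powi (i - 1) * x)) = P (Q powi i * x)"
    using assms by (simp add: power_int_diff)
  thus ?case using step[of "Q powi (i - 1) * x"] step2 assms by simp
qed

text \<open>
  The closed annulus between the circles of radius \<open>norm Q\<close> and \<open>1\<close> contains a fundamental domain for
  multiplication by \<open>Q\<close>; the exponent is found by taking logarithms of the norms.
\<close>
lemma ex_orbit_annulus:
  fixes Q x :: complex
  assumes "0 < norm Q" "norm Q < 1" "x \<noteq> 0"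
  shows "\<exists>n. norm Q \<le> norm (Q powi n * x) \<and> norm (Q powi n * x) \<le> 1"
proof -
  define l where "l = - ln (norm Q)"
  have l: "l > 0" using assms by (simp add: l_def)
  define n where "n = \<lceil>ln (norm x) / l\<rceil>"
  have "of_int n \<ge> ln (norm x) / l" "of_int n < ln (norm x) / l + 1"
    unfolding n_def by linarith+
  hence n: "of_int n * l \<ge> ln (norm x)" "of_int n * l < ln (norm x) + l"
    using l by (simp_all add: field_simps)
  have "norm (Q powi n * x) = norm Q powr of_int n * norm x"
    using assms by (simp add: norm_mult norm_power_int powr_real_of_int')
  also have "\<dots> = exp (ln (norm x) - of_int n * l)"
    using assms by (simp add: powr_def l_def exp_add field_simps)
  finally have *: "norm (Q powi n * x) = exp (ln (norm x) - of_int n * l)" .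
  have "norm Q = exp (- l)" using assms by (simp add: l_def)
  thus ?thesis using * n by (intro exI[of _ n]) auto
qed

text \<open>
  Values of \<open>H\<close> are already taken on the compact annulus, so \<open>H \<circ> exp\<close> is a bounded entire function.
  Passing to \<open>exp\<close> avoids any analysis of the singularity at \<open>0\<close>.
\<close>
lemma periodic_holomorphic_constant:
  assumes Q: "0 < norm Q" "norm Q < 1"
    and H: "H holomorphic_on - {0}" and per: "\<And>x. x \<noteq> 0 \<Longrightarrow> H (Q * x) = H x"
    and "x \<noteq> 0" "y \<noteq> 0"
  shows "H x = H y"
proof -
  define K where "K = cball (0::complex) 1 - ball 0 (norm Q)"
  have "compact K" unfolding K_def by (intro compact_diff) auto
  moreover have "K \<subseteq> - {0}" using Q by (auto simp: K_def)
  ultimately have "bounded (H ` K)"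
    using H by (meson compact_continuous_image compact_imp_bounded continuous_on_subset
        holomorphic_on_imp_continuous_on)
  moreover have "range (H \<circ> exp) \<subseteq> H ` K"
  proof safe
    fix w :: complex
    obtain n where "norm Q \<le> norm (Q powi n * exp w)" "norm (Q powi n * exp w) \<le> 1"
      using ex_orbit_annulus[OF Q, of "exp w"] by auto
    hence "Q powi n * exp w \<in> K" by (auto simp: K_def)
    moreover have "H (Q powi n * exp w) = H (exp w)"
      using orbit_invariant[of Q "\<lambda>x. H x = H (exp w)" "exp w" n] Q per by auto
    ultimately show "(H \<circ> exp) w \<in> H ` K" by (metis comp_apply image_eqI)
  qed
  ultimately have "bounded (range (H \<circ> exp))" by (rule bounded_subset)
  moreover have "(H \<circ> exp) holomorphic_on UNIV"
    by (rule holomorphic_on_compose_gen[OF _ H]) (auto intro: holomorphic_intros)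
  ultimately have "(H \<circ> exp) constant_on UNIV" by (intro Liouville_theorem)
  hence "H (exp (Ln x)) = H (exp (Ln y))" by (metis UNIV_I comp_apply constant_on_def)
  thus ?thesis using assms by simp
qed

definition simple_zeros :: "(complex \<Rightarrow> complex) \<Rightarrow> bool" where
  "simple_zeros G \<longleftrightarrow> (\<forall>x. x \<noteq> 0 \<longrightarrow> G x = 0 \<longrightarrow> deriv G x \<noteq> 0)"

text \<open>
  At a common zero the factor \<open>x - a\<close> cancels from numerator and denominator, which leaves the quotient
  of the derivatives. This is the removable singularity theorem with the extension written explicitly.
\<close>
lemma holomorphic_quotient_simple_zeros:
  assumes F: "F holomorphic_on - {0}" and G: "G holomorphic_on - {0}"
    and simple: "simple_zeros G" and zero: "\<And>x. x \<noteq> 0 \<Longrightarrow> G x = 0 \<Longrightarrow> F x = 0"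
  defines "H \<equiv> \<lambda>x. if G x = 0 then deriv F x / deriv G x else F x / G x"
  shows "H holomorphic_on - {0}"
    and "\<And>x. x \<noteq> 0 \<Longrightarrow> eventually (\<lambda>y. G y \<noteq> 0) (at x)"
proof -
  have near_point: "\<exists>U. open U \<and> a \<in> U \<and> U \<subseteq> - {0} \<and> H holomorphic_on U \<and> (\<forall>y\<in>U - {a}. G y \<noteq> 0)"
    if a: "a \<noteq> 0" for a
  proof (cases "G a = 0")
    case False
    define U where "U = - {0} \<inter> G -` (- {0})"
    have U: "open U"
      unfolding U_def using G
      by (intro continuous_open_preimage holomorphic_on_imp_continuous_on) auto
    have "(\<lambda>y. F y / G y) holomorphic_on U"
      by (intro holomorphic_intros holomorphic_on_subset[OF F] holomorphic_on_subset[OF G])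
         (auto simp: U_def)
    hence "H holomorphic_on U"
      by (rule holomorphic_transform) (auto simp: U_def H_def)
    thus ?thesis using U False a by (intro exI[of _ U]) (auto simp: U_def)
  next
    case True
    define f where "f = (\<lambda>y. if y = a then deriv F a else (F y - F a) / (y - a))"
    define g where "g = (\<lambda>y. if y = a then deriv G a else (G y - G a) / (y - a))"
    have f: "f holomorphic_on - {0}" unfolding f_def by (rule pole_lemma_open[OF F]) auto
    have g: "g holomorphic_on - {0}" unfolding g_def by (rule pole_lemma_open[OF G]) auto
    define U where "U = - {0} \<inter> g -` (- {0})"
    have U: "open U"
      unfolding U_def using g
      by (intro continuous_open_preimage holomorphic_on_imp_continuous_on) auto
    have "g a \<noteq> 0" using simple a True by (simp add: g_def simple_zeros_def)
    hence aU: "a \<in> U" using a by (simp add: U_def)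
    have nz: "G y \<noteq> 0" if "y \<in> U - {a}" for y
      using that True by (auto simp: U_def g_def)
    have "(\<lambda>y. f y / g y) holomorphic_on U"
      by (intro holomorphic_intros holomorphic_on_subset[OF f] holomorphic_on_subset[OF g])
         (auto simp: U_def)
    moreover have "f y / g y = H y" if "y \<in> U" for y
      using that nz[of y] True zero[OF a True] by (auto simp: f_def g_def H_def)
    ultimately have "H holomorphic_on U" by (rule holomorphic_transform)
    thus ?thesis using U aU nz by (intro exI[of _ U]) (auto simp: U_def)
  qed
  show "eventually (\<lambda>y. G y \<noteq> 0) (at x)" if "x \<noteq> 0" for x
    using near_point[OF that] by (auto simp: eventually_at_topological)
  show "H holomorphic_on - {0}"
    unfolding holomorphic_on_def
  proof
    fix a :: complex assume "a \<in> - {0}"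
    then obtain U where "open U" "a \<in> U" "H holomorphic_on U" using near_point[of a] by auto
    thus "H field_differentiable at a within - {0}"
      using holomorphic_on_imp_differentiable_at field_differentiable_at_within by blast
  qed
qed

text \<open>
  The quotient of two functions with the same multiplier is invariant under \<open>x \<mapsto> Q * x\<close>; once it is
  known to be holomorphic, it is constant. All theta identities below are instances.
\<close>
lemma quasi_periodic_unique:
  assumes Q: "0 < norm Q" "norm Q < 1"
    and F: "F holomorphic_on - {0}" and G: "G holomorphic_on - {0}"
    and mF: "\<And>x. x \<noteq> 0 \<Longrightarrow> F (Q * x) = m x * F x"
    and mG: "\<And>x. x \<noteq> 0 \<Longrightarrow> G (Q * x) = m x * G x"
    and m: "\<And>x. x \<noteq> 0 \<Longrightarrow> m x \<noteq> 0"
    and simple: "simple_zeros G" and zero: "\<And>x. x \<noteq> 0 \<Longrightarrow> G x = 0 \<Longrightarrow> F x = 0"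
    and b: "b \<noteq> 0" "G b \<noteq> 0" "F b = C * G b" and x: "x \<noteq> 0"
  shows "F x = C * G x"
proof -
  define H where "H = (\<lambda>x. if G x = 0 then deriv F x / deriv G x else F x / G x)"
  have H: "H holomorphic_on - {0}"
    unfolding H_def by (rule holomorphic_quotient_simple_zeros(1)[OF F G simple zero])
  have nz: "eventually (\<lambda>y. G y \<noteq> 0) (at x)" if "x \<noteq> 0" for x
    by (rule holomorphic_quotient_simple_zeros(2)[OF F G simple zero that])
  have cont: "isCont H x" if "x \<noteq> 0" for x
    using holomorphic_on_imp_continuous_on[OF H] that
    by (simp add: continuous_on_eq_continuous_at open_Compl)
  \<comment> \<open>At zeros of \<open>G\<close> periodicity follows by continuity, because zeros of \<open>G\<close> are isolated.\<close>
  have per: "H (Q * x) = H x" if x: "x \<noteq> 0" for x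
  proof (rule tendsto_unique)
    show "((\<lambda>y. H (Q * y)) \<longlongrightarrow> H (Q * x)) (at x)"
      using isContD[OF isCont_o2[of x "\<lambda>y. Q * y" H]] cont[of "Q * x"] x Q by auto
    have "eventually (\<lambda>y. y \<noteq> 0) (at x)"
      using x by (simp add: eventually_at_topological) (metis Compl_iff open_Compl closed_singleton singletonD singletonI)
    hence "eventually (\<lambda>y. H (Q * y) = H y) (at x)"
      using nz[OF x] by eventually_elim (simp add: H_def mF mG m)
    moreover have "(H \<longlongrightarrow> H x) (at x)" using cont[OF x] by (rule isContD)
    ultimately show "((\<lambda>y. H (Q * y)) \<longlongrightarrow> H x) (at x)"
      by (subst tendsto_cong)
  qed simp
  have "H x = H b" by (rule periodic_holomorphic_constant[OF Q H per]) (use x b in auto)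
  thus ?thesis using b zero[OF x] by (cases "G x = 0") (auto simp: H_def field_simps)
qed

section \<open>Functional equations and zeros of the theta function\<close>

lemma simple_zerosD: "simple_zeros G \<Longrightarrow> x \<noteq> 0 \<Longrightarrow> G x = 0 \<Longrightarrow> deriv G x \<noteq> 0"
  by (simp add: simple_zeros_def)

lemma holomorphic_punctured_DERIV:
  assumes "f holomorphic_on - {0}" "x \<noteq> (0::complex)"
  shows "(f has_field_derivative deriv f x) (at x)"
  by (rule holomorphic_derivI[OF assms(1)]) (use assms in auto)

lemma simple_zeros_mult:
  assumes hol: "F holomorphic_on - {0}" "G holomorphic_on - {0}"
    and simple: "simple_zeros F" "simple_zeros G"
    and disj: "\<And>x. x \<noteq> 0 \<Longrightarrow> F x = 0 \<Longrightarrow> G x \<noteq> 0"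
  shows "simple_zeros (\<lambda>x. F x * G x)"
  unfolding simple_zeros_def
proof (intro allI impI)
  fix x :: complex assume x: "x \<noteq> 0" and z: "F x * G x = 0"
  have "deriv (\<lambda>x. F x * G x) x = deriv F x * G x + deriv G x * F x"
    using DERIV_mult[OF holomorphic_punctured_DERIV[OF hol(1) x] holomorphic_punctured_DERIV[OF hol(2) x]]
    by (rule DERIV_imp_deriv)
  thus "deriv (\<lambda>x. F x * G x) x \<noteq> 0"
    using z simple_zerosD[OF simple(1) x] simple_zerosD[OF simple(2) x] disj[OF x]
    by (cases "F x = 0") simp_all
qed

text \<open>
  For \<open>x \<noteq> 0\<close> the derivative of \<open>c * x ^ k\<close> does not vanish, so substituting a monomial keeps zeros simple.
\<close>
lemma simple_zeros_monomial:
  assumes hol: "G holomorphic_on - {0}" and simple: "simple_zeros G" and "c \<noteq> 0" "k > 0"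
  shows "simple_zeros (\<lambda>x. G (c * x ^ k))"
  unfolding simple_zeros_def
proof (intro allI impI)
  fix x :: complex assume x: "x \<noteq> 0" and z: "G (c * x ^ k) = 0"
  have nz: "c * x ^ k \<noteq> 0" using x assms by simp
  have "((\<lambda>x. c * x ^ k) has_field_derivative (c * (of_nat k * x ^ (k - 1)))) (at x)"
    by (auto intro!: derivative_eq_intros)
  from DERIV_chain2[OF holomorphic_punctured_DERIV[OF hol nz] this]
  have "deriv (\<lambda>x. G (c * x ^ k)) x = deriv G (c * x ^ k) * (c * (of_nat k * x ^ (k - 1)))"
    by (rule DERIV_imp_deriv)
  thus "deriv (\<lambda>x. G (c * x ^ k)) x \<noteq> 0"
    using x assms simple_zerosD[OF simple nz z] by simp
qed

lemma qpoch_inf_compose_holomorphic [holomorphic_intros]: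
  assumes "norm Q < 1" "f holomorphic_on A"
  shows "(\<lambda>x. qpoch_inf (f x) Q) holomorphic_on A"
  using holomorphic_on_compose[OF assms(2) qpoch_inf_holomorphic[OF assms(1)]]
  by (simp add: o_def)

lemma Theta_holomorphic:
  assumes "norm Q < 1"
  shows "(\<lambda>x. Theta x Q) holomorphic_on - {0}"
  unfolding Theta_def by (intro holomorphic_intros assms) auto

lemma Theta_compose_holomorphic [holomorphic_intros]:
  assumes "norm Q < 1" "f holomorphic_on A" "\<And>x. x \<in> A \<Longrightarrow> f x \<noteq> 0"
  shows "(\<lambda>x. Theta (f x) Q) holomorphic_on A"
proof -
  have "f ` A \<subseteq> - {0}" using assms(3) by auto
  from holomorphic_on_compose_gen[OF assms(2) Theta_holomorphic[OF assms(1)] this]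
  show ?thesis by (simp add: o_def)
qed

context
  fixes Q :: complex
  assumes Q: "0 < norm Q" "norm Q < 1"
begin

lemma Theta_1 [simp]: "Theta 1 Q = 0"
  using qpoch_inf_shift[OF Q(2), of 1] by (simp add: Theta_def)

lemma Theta_reflect: "x \<noteq> 0 \<Longrightarrow> Theta (Q / x) Q = Theta x Q"
  using Q by (auto simp: Theta_def)

text \<open>
  Shifting moves one factor from each of the two \<open>x\<close>-dependent products: \<open>1 - x\<close> disappears and
  \<open>1 - 1 / x\<close> appears. At \<open>x = 1\<close>, where one cannot cancel, both sides vanish.
\<close>
lemma Theta_shift:
  assumes "x \<noteq> 0"
  shows "Theta (Q * x) Q = - Theta x Q / x"
proof (cases "x = 1")
  case True
  thus ?thesis using Theta_reflect[of 1] by simp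
next
  case False
  have "(1 - x) * Theta (Q * x) Q = ((1 - x) * qpoch_inf (Q * x) Q) * qpoch_inf (1 / x) Q * qpoch_inf Q Q"
    using Q by (auto simp: Theta_def)
  also have "(1 - x) * qpoch_inf (Q * x) Q = qpoch_inf x Q"
    by (rule qpoch_inf_shift[OF Q(2), symmetric])
  also have "qpoch_inf (1 / x) Q = (1 - 1 / x) * qpoch_inf (Q / x) Q"
    using qpoch_inf_shift[OF Q(2), of "1 / x"] by simp
  also have "qpoch_inf x Q * ((1 - 1 / x) * qpoch_inf (Q / x) Q) * qpoch_inf Q Q
      = (1 - x) * (- Theta x Q / x)"
    using assms by (simp add: Theta_def field_simps)
  finally show ?thesis using False mult_left_cancel[of "1 - x"] by (metis eq_iff_diff_eq_0)
qed

lemma Theta_inverse: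
  assumes "x \<noteq> 0"
  shows "Theta (1 / x) Q = - Theta x Q / x"
proof -
  have "Theta x Q = - (x * Theta (1 / x) Q)"
    using Theta_reflect[OF assms] Theta_shift[of "1 / x"] assms by simp
  thus ?thesis using assms by simp
qed

lemma Theta_eq_0_iff:
  assumes "x \<noteq> 0"
  shows "Theta x Q = 0 \<longleftrightarrow> (\<exists>n. x = Q powi n)"
proof
  assume "Theta x Q = 0"
  then consider i where "Q ^ i * x = 1" | i where "Q ^ i * (Q / x) = 1"
    using qpoch_inf_self_nonzero[OF Q(2)] by (auto simp: Theta_def qpoch_inf_eq_0_iff[OF Q(2)])
  thus "\<exists>n. x = Q powi n"
  proof cases
    case 1
    hence "x = Q powi (- int i)" using Q by (auto simp: power_int_minus field_simps)
    thus ?thesis ..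
  next
    case 2
    hence "x = Q ^ Suc i" using assms by (simp add: field_simps)
    hence "x = Q powi (int (Suc i))" by (simp only: power_int_of_nat)
    thus ?thesis ..
  qed
next
  assume "\<exists>n. x = Q powi n"
  then obtain n where "x = Q powi n * 1" by auto
  thus "Theta x Q = 0"
    using orbit_invariant[of Q "\<lambda>x. Theta x Q = 0" 1 n] Q by (auto simp: Theta_shift)
qed

lemma powi_eq_1_norm: "norm (Q powi n) = 1 \<longleftrightarrow> n = 0"
proof
  assume "norm (Q powi n) = 1"
  hence "norm Q powr of_int n = 1" using Q by (simp add: norm_power_int powr_real_of_int')
  thus "n = 0" using Q by (simp add: powr_eq_one_iff_gen)
qed simp

lemma Theta_nonzero_norm_1:
  assumes "norm x = 1" "x \<noteq> 1"
  shows "Theta x Q \<noteq> 0"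
proof
  have "x \<noteq> 0" using assms by auto
  moreover assume "Theta x Q = 0"
  ultimately obtain n where n: "x = Q powi n" by (auto simp: Theta_eq_0_iff)
  hence "n = 0" using assms powi_eq_1_norm by auto
  thus False using n assms by simp
qed

text \<open>
  At \<open>1\<close> the factor \<open>1 - x\<close> splits off and the rest is a nonvanishing product. Differentiating
  \<open>Theta (Q * x) Q = - Theta x Q / x\<close> at a zero carries this to all other zeros.
\<close>
lemma Theta_simple_zeros: "simple_zeros (\<lambda>x. Theta x Q)"
proof -
  let ?D = "deriv (\<lambda>x. Theta x Q)"
  define P where "P = (\<lambda>x. Theta x Q = 0 \<and> ?D x \<noteq> 0)"
  have hol: "(\<lambda>x. Theta x Q) holomorphic_on - {0}" by (rule Theta_holomorphic[OF Q(2)])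
  have step: "P (Q * x) = P x" if x: "x \<noteq> 0" for x
  proof -
    have Qx: "Q * x \<noteq> 0" using x Q by auto
    have "((\<lambda>y. - Theta y Q / y) has_field_derivative ?D (Q * x) * Q) (at x)"
    proof (rule has_field_derivative_transform_within_open)
      show "((\<lambda>y. Theta (Q * y) Q) has_field_derivative ?D (Q * x) * Q) (at x)"
        by (rule DERIV_chain2[where f = "\<lambda>x. Theta x Q" and g = "\<lambda>y. Q * y",
              OF holomorphic_punctured_DERIV[OF hol Qx]])
           (auto intro!: derivative_eq_intros)
      show "open (- {0::complex})" by (simp add: open_Compl)
    qed (use x in \<open>auto simp: Theta_shift\<close>)
    moreover have "((\<lambda>y. - Theta y Q / y) has_field_derivative (- ?D x * x + Theta x Q) / (x * x)) (at x)"
      by (rule derivative_eq_intros holomorphic_punctured_DERIV[OF hol x] refl)+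
         (use x in \<open>simp_all add: field_simps\<close>)
    ultimately have D: "?D (Q * x) * Q = (- ?D x * x + Theta x Q) / (x * x)" by (rule DERIV_unique)
    have "?D (Q * x) = 0 \<longleftrightarrow> ?D x = 0" if "Theta x Q = 0"
    proof -
      have "?D (Q * x) * Q = - ?D x / x" using D that x by (simp add: divide_simps)
      thus ?thesis using x Q by (metis Qx divide_eq_0_iff mult_eq_0_iff neg_equal_0_iff_equal)
    qed
    moreover have "Theta (Q * x) Q = 0 \<longleftrightarrow> Theta x Q = 0" using x by (simp add: Theta_shift)
    ultimately show ?thesis unfolding P_def by blast
  qed
  have "P 1"
  proof -
    define f where "f = (\<lambda>x. qpoch_inf (Q * x) Q * qpoch_inf (Q / x) Q * qpoch_inf Q Q)"
    have f: "f holomorphic_on - {0}"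
      unfolding f_def by (intro holomorphic_intros Q(2)) auto
    have "((\<lambda>x. (1 - x) * f x) has_field_derivative - f 1) (at 1)"
      using holomorphic_punctured_DERIV[OF f, of 1] by (auto intro!: derivative_eq_intros)
    moreover have "(\<lambda>x. Theta x Q) = (\<lambda>x. (1 - x) * f x)"
    proof
      show "Theta x Q = (1 - x) * f x" for x
        using qpoch_inf_shift[OF Q(2), of x] by (simp add: Theta_def f_def)
    qed
    ultimately have "?D 1 = - f 1" by (simp add: DERIV_imp_deriv)
    thus ?thesis using qpoch_inf_self_nonzero[OF Q(2)] by (simp add: P_def f_def)
  qed
  thus ?thesis
    using orbit_invariant[of Q P 1] step Q by (auto simp: simple_zeros_def Theta_eq_0_iff P_def)
qed

end

section \<open>The quintuple product identity and the cubic theta form\<close>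

text \<open>
  The zeros of \<open>Theta (x ^ k) Q\<close> satisfy \<open>x ^ k = Q powi n\<close>. Multiplying \<open>x\<close> by a power of \<open>Q\<close> changes
  \<open>n\<close> by a multiple of \<open>k\<close>, so only \<open>k\<close> values of \<open>n\<close> have to be examined.
\<close>
lemma vanish_on_power_orbit:
  fixes Q x :: complex
  assumes Q: "0 < norm Q"
    and mF: "\<And>x. x \<noteq> 0 \<Longrightarrow> F (Q * x) = m x * F x" and m: "\<And>x. x \<noteq> 0 \<Longrightarrow> m x \<noteq> 0"
    and k: "k > 0" and base: "\<And>y j. y \<noteq> 0 \<Longrightarrow> j < k \<Longrightarrow> Q ^ j * y ^ k = 1 \<Longrightarrow> F y = (0::complex)"
    and x: "x \<noteq> 0" "x ^ k = Q powi n"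
  shows "F x = 0"
proof -
  have Q0: "Q \<noteq> 0" using Q by auto
  \<comment> \<open>Division with remainder of \<open>- n\<close> by \<open>k\<close> makes the remaining exponent \<open>- j\<close> with \<open>0 \<le> j < k\<close>.\<close>
  define m j where "m = (- n) div int k" and "j = nat ((- n) mod int k)"
  have j: "int j = (- n) mod int k" "j < k" using k by (auto simp: j_def nat_less_iff)
  have "int k * m + int j = - n" unfolding m_def j(1) by simp
  hence e: "int j + (int k * m + n) = 0" by simp
  have "Q ^ j * (Q powi m * x) ^ k = Q powi int j * (Q powi (int k * m) * Q powi n)"
    using x by (simp add: power_mult_distrib power_int_mult mult.commute[of "int k"])
  also have "\<dots> = Q powi (int j + (int k * m + n))" using Q0 by (simp add: power_int_add)
  finally have "Q ^ j * (Q powi m * x) ^ k = 1" by (simp add: e)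
  hence "F (Q powi m * x) = 0" using x Q0 j by (intro base) auto
  moreover have "(F (Q powi m * x) = 0) = (F x = 0)"
    using Q0 x by (intro orbit_invariant[of Q "\<lambda>x. F x = 0"]) (auto simp: mF m)
  ultimately show ?thesis by simp
qed

lemma norm_power_nome:
  fixes Q :: complex
  assumes "0 < norm Q" "norm Q < 1" "k > 0"
  shows "0 < norm (Q ^ k)" "norm (Q ^ k) < 1"
proof -
  show "0 < norm (Q ^ k)" using assms by auto
  show "norm (Q ^ k) < 1" using assms power_less_one_iff[of "norm Q" k] by (simp add: norm_power)
qed

text \<open>
  The next three rules restate the functional equations with free arguments, so that an instance is
  selected by the shape of the goal and the arithmetic of the arguments becomes a side condition.
\<close>
lemma Theta_shift_eq:
  assumes "0 < norm Q" "norm Q < 1" "x \<noteq> 0" "y = Q * x"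
  shows "Theta y Q = - Theta x Q / x"
  using Theta_shift[OF assms(1-3)] assms(4) by simp

lemma Theta_reflect_eq:
  assumes "0 < norm Q" "norm Q < 1" "x \<noteq> 0" "x * y = Q"
  shows "Theta y Q = Theta x Q"
proof -
  have "y = Q / x" using assms by (auto simp: field_simps)
  thus ?thesis using Theta_reflect[OF assms(1-3)] by simp
qed

lemma Theta_inverse_eq:
  assumes "0 < norm Q" "norm Q < 1" "x * y = 1"
  shows "Theta y Q = - Theta x Q / x"
proof -
  have "x \<noteq> 0" using assms by auto
  moreover from this have "y = 1 / x" using assms(3) by (simp add: field_simps)
  ultimately have "x \<noteq> 0" "y = 1 / x" by auto
  thus ?thesis using Theta_inverse[OF assms(1-2)] by simp
qed

text \<open>
  The exponents congruent to \<open>1\<close>, \<open>2\<close> and \<open>0\<close> modulo \<open>3\<close> together give all factors of \<open>qpoch_inf Q Q\<close>.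
\<close>
lemma Theta_cube_nome:
  assumes "0 < norm Q" "norm Q < 1"
  shows "Theta Q (Q ^ 3) = qpoch_inf Q Q" "Theta (Q ^ 2) (Q ^ 3) = qpoch_inf Q Q"
proof -
  have "Q ^ 3 / Q = Q ^ 2" using assms by (auto simp: power3_eq_cube power2_eq_square)
  moreover have "{..<3::nat} = {0, 1, 2}" by auto
  ultimately show *: "Theta Q (Q ^ 3) = qpoch_inf Q Q"
    using qpoch_inf_split[OF assms(2), of 3 Q]
    by (simp add: Theta_def power2_eq_square power3_eq_cube mult_ac)
  show "Theta (Q ^ 2) (Q ^ 3) = qpoch_inf Q Q"
    unfolding *[symmetric]
    by (rule Theta_reflect_eq[OF norm_power_nome[OF assms]])
       (use assms in \<open>auto simp: power2_eq_square power3_eq_cube\<close>)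
qed

lemma ex_primitive_cube_root:
  obtains w :: complex where "w ^ 3 = 1" "w \<noteq> 1" "norm w = 1" "1 + w + w ^ 2 = 0"
proof -
  define w where "w = cis (2 * pi / 3)"
  have "w ^ 3 = cis (2 * pi)" unfolding w_def by (simp add: Complex.DeMoivre)
  hence 1: "w ^ 3 = 1" by simp
  have "Re w \<noteq> 1" by (simp add: w_def cos_120)
  hence 2: "w \<noteq> 1" by auto
  have "(w - 1) * (1 + w + w ^ 2) = 0"
    using 1 by (simp add: algebra_simps power2_eq_square power3_eq_cube)
  hence "1 + w + w ^ 2 = 0" using 2 by simp
  thus ?thesis using 1 2 that[of w] by (simp add: w_def)
qed

text \<open>
  As functions of \<open>x\<close> both sides have the multiplier \<open>1 / (Q * x ^ 4)\<close>. The left-hand side vanishes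
  whenever \<open>x ^ 2\<close> is a power of \<open>Q\<close>: up to the orbit either \<open>x = 1\<close>, where the first factor vanishes,
  or \<open>x = -1\<close> or \<open>Q * x ^ 2 = 1\<close>, where the two summands cancel by the reflection and inversion formulas.
  The constant is read off at a primitive third root of unity, where both inner theta functions equal
  \<open>qpoch_inf Q Q\<close>.
\<close>
theorem quintuple_product:
  assumes Q: "0 < norm Q" "norm Q < 1" and x: "x \<noteq> 0"
  shows "Theta x Q * (Theta (Q * x ^ 3) (Q ^ 3) + x * Theta (Q ^ 2 * x ^ 3) (Q ^ 3))
    = qpoch_inf Q Q * Theta (x ^ 2) Q"
proof -
  define F where "F = (\<lambda>x. Theta x Q * (Theta (Q * x ^ 3) (Q ^ 3) + x * Theta (Q ^ 2 * x ^ 3) (Q ^ 3)))"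
  define G where "G = (\<lambda>x. Theta (x ^ 2) Q)"
  define m where "m = (\<lambda>x. 1 / (Q * x ^ 4))"
  have Q0: "Q \<noteq> 0" using Q by auto
  have Q3: "0 < norm (Q ^ 3)" "norm (Q ^ 3) < 1" by (rule norm_power_nome[OF Q]; simp)+
  have holF: "F holomorphic_on - {0}"
    unfolding F_def by (intro holomorphic_intros Q Q3) (auto simp: Q0)
  have holG: "G holomorphic_on - {0}"
    unfolding G_def by (intro holomorphic_intros Q Q3) auto
  have simple: "simple_zeros G"
    using simple_zeros_monomial[OF Theta_holomorphic[OF Q(2)] Theta_simple_zeros[OF Q], of 1 2]
    by (simp add: G_def)
  have mG: "G (Q * x) = m x * G x" if x: "x \<noteq> 0" for x
  proof -
    have "Theta ((Q * x) ^ 2) Q = - Theta (Q * x ^ 2) Q / (Q * x ^ 2)"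
      by (rule Theta_shift_eq[OF Q]) (use x Q0 in \<open>auto simp: power2_eq_square\<close>)
    moreover have "Theta (Q * x ^ 2) Q = - Theta (x ^ 2) Q / x ^ 2"
      by (rule Theta_shift_eq[OF Q]) (use x in auto)
    ultimately show ?thesis by (simp add: G_def m_def power_numeral_reduce mult_ac)
  qed
  have mF: "F (Q * x) = m x * F x" if x: "x \<noteq> 0" for x
  proof -
    have 1: "Theta (Q * x) Q = - Theta x Q / x"
      by (rule Theta_shift_eq[OF Q]) (use x in auto)
    have 2: "Theta (Q * (Q * x) ^ 3) (Q ^ 3) = - Theta (Q * x ^ 3) (Q ^ 3) / (Q * x ^ 3)"
      by (rule Theta_shift_eq[OF Q3]) (use x Q0 in \<open>auto simp: power_mult_distrib\<close>)
    have 3: "Theta (Q ^ 2 * (Q * x) ^ 3) (Q ^ 3) = - Theta (Q ^ 2 * x ^ 3) (Q ^ 3) / (Q ^ 2 * x ^ 3)"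
      by (rule Theta_shift_eq[OF Q3]) (use x Q0 in \<open>auto simp: power_mult_distrib\<close>)
    show ?thesis using x Q0
      by (simp only: F_def m_def 1 2 3) (simp add: field_simps power_numeral_reduce)
  qed
  have m: "m x \<noteq> 0" if "x \<noteq> 0" for x using that Q0 by (simp add: m_def)
  have zero: "F x = 0" if x: "x \<noteq> 0" and z: "G x = 0" for x
  proof -
    have "x ^ 2 \<noteq> 0" using x by simp
    then obtain n where n: "x ^ 2 = Q powi n" using z by (auto simp: G_def Theta_eq_0_iff[OF Q])
    show ?thesis
    proof (rule vanish_on_power_orbit[where F = F and m = m and k = 2, OF Q(1) mF m _ _ x n])
      fix y :: complex and j :: nat
      assume y: "y \<noteq> 0" "j < 2" and e: "Q ^ j * y ^ 2 = 1"
      consider "j = 0" | "j = 1" using y by linarith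
      thus "F y = 0"
      proof cases
        case 1
        hence "y = 1 \<or> y = - 1" using e by (simp add: power2_eq_1_iff)
        moreover have "Theta (- (Q ^ 2)) (Q ^ 3) = Theta (- Q) (Q ^ 3)"
          by (rule Theta_reflect_eq[OF Q3]) (use Q0 in \<open>auto simp: power2_eq_square power3_eq_cube\<close>)
        ultimately show ?thesis by (auto simp: F_def Theta_1[OF Q])
      next
        case 2
        hence e: "Q * y ^ 2 = 1" using e by simp
        have "Q * y ^ 3 = (Q * y ^ 2) * y" "Q ^ 2 * y ^ 3 = (Q * y ^ 2) * (Q * y)"
          by (simp_all add: power2_eq_square power3_eq_cube mult_ac)
        hence "Q * y ^ 3 = y" "Q ^ 2 * y ^ 3 = Q * y" by (simp_all add: e)
        moreover have "Theta (Q * y) (Q ^ 3) = - Theta y (Q ^ 3) / y"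
          by (rule Theta_inverse_eq[OF Q3]) (use e in \<open>simp add: power2_eq_square mult_ac\<close>)
        ultimately show ?thesis using y by (simp add: F_def)
      qed
    qed auto
  qed
  obtain w :: complex where w: "w ^ 3 = 1" "w \<noteq> 1" "norm w = 1" "1 + w + w ^ 2 = 0"
    by (rule ex_primitive_cube_root)
  have w0: "w \<noteq> 0" using w by auto
  have Gw: "G w = (1 + w) * Theta w Q"
  proof -
    have "w * w ^ 2 = 1" using w(1) by (simp add: power_numeral_reduce)
    hence Gw: "G w = - Theta w Q / w" unfolding G_def by (rule Theta_inverse_eq[OF Q])
    have "(1 + w) * w = - 1" using w(4) by (simp add: power2_eq_square algebra_simps eq_neg_iff_add_eq_0)
    hence "w * ((1 + w) * Theta w Q) = - Theta w Q" by (metis mult.assoc mult.commute mult_minus1)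
    hence "w * ((1 + w) * Theta w Q) = w * G w" using Gw w0 by simp
    thus ?thesis using w0 by simp
  qed
  have "1 + w \<noteq> 0" using w(4) w0 by auto
  hence Gw0: "G w \<noteq> 0" using Gw Theta_nonzero_norm_1[OF Q w(3,2)] by simp
  have "F w = qpoch_inf Q Q * G w"
    using w by (simp add: F_def Gw Theta_cube_nome[OF Q] algebra_simps)
  from quasi_periodic_unique[OF Q holF holG mF mG m simple zero w0 Gw0 this x]
  show ?thesis by (simp add: F_def G_def)
qed


text \<open>
  The sum of products of thetas of \<open>u^3\<close> and quintuple product sums in \<open>u^2\<close>, with \<open>q^9\<close> as the nome.
  Reordered by the thetas of \<open>u^6\<close>, it is the corresponding sum with quintuple product sums in \<open>u\<close>,
  divided by \<open>u\<close>.
\<close>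
definition cubic_theta_form :: "complex \<Rightarrow> complex \<Rightarrow> complex" where
  "cubic_theta_form q u = 
     Theta (q ^ 3 * u ^ 3) (q ^ 9) * (Theta (q ^ 3 * u ^ 6) (q ^ 9) + u ^ 2 * Theta (q ^ 6 * u ^ 6) (q ^ 9))
   + u * q * Theta (u ^ 3) (q ^ 9) * (Theta (q ^ 6 * u ^ 6) (q ^ 9) - q / u ^ 4 * Theta (u ^ 6) (q ^ 9))
   + u * Theta (q ^ 6 * u ^ 3) (q ^ 9) * (Theta (q ^ 3 * u ^ 6) (q ^ 9) + q / u ^ 2 * Theta (u ^ 6) (q ^ 9))"

text \<open>
  Both sides have the multiplier \<open>- 1 / (q ^ 3 * u ^ 9)\<close>. The zeros of the right-hand side fall into three
  classes. If \<open>u ^ 3 = 1\<close>, the form is a multiple of \<open>1 + u + u ^ 2\<close>, and at \<open>u = 1\<close> the factor \<open>Theta u q\<close>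
  vanishes; if \<open>q * u ^ 3 = 1\<close>, the six terms of the form cancel in pairs; if \<open>q ^ 2 * u ^ 3 = 1\<close>, the
  last factor vanishes. The constant is obtained at \<open>u = -1\<close> with the quintuple product identity for
  nome \<open>q ^ 3\<close> at \<open>- q\<close>.
\<close>
theorem cubic_theta_form_product:
  assumes q: "0 < norm q" "norm q < 1" and u: "u \<noteq> 0"
  shows "cubic_theta_form q u * Theta u q * Theta (q ^ 2 * u ^ 3) (q ^ 3)
    = qpoch_inf q q * (qpoch_inf (q ^ 3) (q ^ 3)) ^ 2 * Theta (u ^ 3) q"
proof -
  define F where "F = (\<lambda>u. cubic_theta_form q u * Theta u q * Theta (q ^ 2 * u ^ 3) (q ^ 3))"
  define G where "G = (\<lambda>u. Theta (u ^ 3) q)"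
  define m where "m = (\<lambda>u. - 1 / (q ^ 3 * u ^ 9))"
  have q0: "q \<noteq> 0" using q by auto
  have q3: "0 < norm (q ^ 3)" "norm (q ^ 3) < 1" by (rule norm_power_nome[OF q]; simp)+
  have q9: "0 < norm (q ^ 9)" "norm (q ^ 9) < 1" by (rule norm_power_nome[OF q]; simp)+
  have holF: "F holomorphic_on - {0}"
    unfolding F_def cubic_theta_form_def by (intro holomorphic_intros q q3 q9) (auto simp: q0)
  have holG: "G holomorphic_on - {0}"
    unfolding G_def by (intro holomorphic_intros q) auto
  have simple: "simple_zeros G"
    using simple_zeros_monomial[OF Theta_holomorphic[OF q(2)] Theta_simple_zeros[OF q], of 1 3]
    by (simp add: G_def)
  have mG: "G (q * x) = m x * G x" if x: "x \<noteq> 0" for x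
  proof -
    have 1: "Theta ((q * x) ^ 3) q = - Theta (q ^ 2 * x ^ 3) q / (q ^ 2 * x ^ 3)"
      by (rule Theta_shift_eq[OF q]) (use x q0 in \<open>auto simp: power_numeral_reduce\<close>)
    have 2: "Theta (q ^ 2 * x ^ 3) q = - Theta (q * x ^ 3) q / (q * x ^ 3)"
      by (rule Theta_shift_eq[OF q]) (use x q0 in \<open>auto simp: power2_eq_square\<close>)
    have 3: "Theta (q * x ^ 3) q = - Theta (x ^ 3) q / x ^ 3"
      by (rule Theta_shift_eq[OF q]) (use x in auto)
    show ?thesis using x q0
      by (simp only: G_def m_def 1 2 3) (simp add: field_simps power_numeral_reduce)
  qed
  have mF: "F (q * x) = m x * F x" if x: "x \<noteq> 0" for x
  proof -
    have A0: "Theta ((q * x) ^ 6) (q ^ 9) = Theta (q ^ 6 * x ^ 6) (q ^ 9)"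
      by (simp add: power_mult_distrib)
    have A1: "Theta (q ^ 3 * (q * x) ^ 6) (q ^ 9) = - Theta (x ^ 6) (q ^ 9) / x ^ 6"
      by (rule Theta_shift_eq[OF q9]) (use x q0 in \<open>auto simp: power_mult_distrib power_numeral_reduce\<close>)
    have A2: "Theta (q ^ 6 * (q * x) ^ 6) (q ^ 9) = - Theta (q ^ 3 * x ^ 6) (q ^ 9) / (q ^ 3 * x ^ 6)"
      by (rule Theta_shift_eq[OF q9]) (use x q0 in \<open>auto simp: power_mult_distrib power_numeral_reduce\<close>)
    have B0: "Theta ((q * x) ^ 3) (q ^ 9) = Theta (q ^ 3 * x ^ 3) (q ^ 9)"
      by (simp add: power_mult_distrib)
    have B1: "Theta (q ^ 3 * (q * x) ^ 3) (q ^ 9) = Theta (q ^ 6 * x ^ 3) (q ^ 9)"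
      by (simp add: power_mult_distrib power_numeral_reduce mult_ac)
    have B2: "Theta (q ^ 6 * (q * x) ^ 3) (q ^ 9) = - Theta (x ^ 3) (q ^ 9) / x ^ 3"
      by (rule Theta_shift_eq[OF q9]) (use x q0 in \<open>auto simp: power_mult_distrib power_numeral_reduce\<close>)
    have 1: "Theta (q * x) q = - Theta x q / x"
      by (rule Theta_shift_eq[OF q]) (use x in auto)
    have 2: "Theta (q ^ 2 * (q * x) ^ 3) (q ^ 3) = - Theta (q ^ 2 * x ^ 3) (q ^ 3) / (q ^ 2 * x ^ 3)"
      by (rule Theta_shift_eq[OF q3]) (use x q0 in \<open>auto simp: power_mult_distrib\<close>)
    have N: "cubic_theta_form q (q * x) = - cubic_theta_form q x / (q * x ^ 5)"
      using x q0
      by (simp only: cubic_theta_form_def A0 A1 A2 B0 B1 B2) (simp add: field_simps power_numeral_reduce)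
    show ?thesis using x q0
      by (simp only: F_def m_def N 1 2) (simp add: field_simps power_numeral_reduce)
  qed
  have m: "m x \<noteq> 0" if "x \<noteq> 0" for x using that q0 by (simp add: m_def)
  have one: "Theta (q ^ 6) (q ^ 9) = qpoch_inf (q ^ 3) (q ^ 3)" "Theta (q ^ 3) (q ^ 9) = qpoch_inf (q ^ 3) (q ^ 3)"
    using Theta_cube_nome[OF q3] by (simp_all flip: power_mult)
  have zero: "F x = 0" if x: "x \<noteq> 0" and z: "G x = 0" for x
  proof -
    have "x ^ 3 \<noteq> 0" using x by simp
    then obtain n where n: "x ^ 3 = q powi n" using z by (auto simp: G_def Theta_eq_0_iff[OF q])
    show ?thesis
    proof (rule vanish_on_power_orbit[where F = F and m = m and k = 3, OF q(1) mF m _ _ x n])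
      fix y :: complex and j :: nat
      assume y: "y \<noteq> 0" "j < 3" and e: "q ^ j * y ^ 3 = 1"
      consider "j = 0" | "j = 1" | "j = 2" using y by linarith
      thus "F y = 0"
      proof cases
        case 1
        hence y3: "y ^ 3 = 1" using e by simp
        moreover have "y ^ 6 = (y ^ 3) ^ 2" by (simp flip: power_mult)
        ultimately have y6: "y ^ 6 = 1" by simp
        have "(y - 1) * (1 + y + y ^ 2) = 0"
          using y3 by (simp add: algebra_simps power2_eq_square power3_eq_cube)
        hence "y = 1 \<or> 1 + y + y ^ 2 = 0" by simp
        moreover have "cubic_theta_form q y = (qpoch_inf (q ^ 3) (q ^ 3)) ^ 2 * (1 + y + y ^ 2)"
          by (simp add: cubic_theta_form_def y3 y6 one Theta_1[OF q9]) (simp add: power2_eq_square algebra_simps)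
        ultimately show ?thesis by (auto simp: F_def Theta_1[OF q])
      next
        case 2
        hence e: "q * y ^ 3 = 1" using e by simp
        define a b c where "a = Theta q (q ^ 9)" and "b = Theta (q ^ 2) (q ^ 9)" and "c = Theta (q ^ 4) (q ^ 9)"
        have y3: "y ^ 3 = 1 / q" using e q0 by (simp add: field_simps)
        have "y ^ 6 = (y ^ 3) ^ 2" by (simp flip: power_mult)
        hence y6: "y ^ 6 = 1 / q ^ 2" by (simp add: y3 power_divide)
        have A0: "Theta (y ^ 6) (q ^ 9) = - b / q ^ 2"
          unfolding b_def by (rule Theta_inverse_eq[OF q9]) (use q0 in \<open>simp add: y6\<close>)
        have "q ^ 3 * y ^ 6 = q"
          unfolding y6 using q0 by (simp add: power_numeral_reduce)
        hence A1: "Theta (q ^ 3 * y ^ 6) (q ^ 9) = a" by (simp add: a_def)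
        have "q ^ 6 * y ^ 6 = q ^ 4"
          unfolding y6 using q0 by (simp add: power_numeral_reduce)
        hence A2: "Theta (q ^ 6 * y ^ 6) (q ^ 9) = c" by (simp add: c_def)
        have B0: "Theta (y ^ 3) (q ^ 9) = - a / q"
          unfolding a_def by (rule Theta_inverse_eq[OF q9]) (use e in simp)
        have "q ^ 3 * y ^ 3 = q ^ 2"
          unfolding y3 using q0 by (simp add: power_numeral_reduce)
        hence B1: "Theta (q ^ 3 * y ^ 3) (q ^ 9) = b" by (simp add: b_def)
        have B2: "Theta (q ^ 6 * y ^ 3) (q ^ 9) = c"
          unfolding c_def by (rule Theta_reflect_eq[OF q9]) (unfold y3, use q0 in \<open>simp_all add: power_numeral_reduce\<close>)
        have y1: "1 / y = q * y ^ 2" using e y by (simp add: field_simps power_numeral_reduce)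
        have "q / y ^ 2 = q * (1 / y) ^ 2" by (simp add: power_divide)
        also have "\<dots> = q ^ 2 * (q * y ^ 3) * y" unfolding y1 by (simp add: power_numeral_reduce)
        finally have y2: "q / y ^ 2 = q ^ 2 * y" by (simp add: e)
        have "q / y ^ 4 = q * (1 / y) ^ 4" by (simp add: power_divide)
        also have "\<dots> = q ^ 3 * (q * y ^ 3) ^ 2 * y ^ 2" unfolding y1 by (simp add: power_numeral_reduce)
        finally have y4: "q / y ^ 4 = q ^ 3 * y ^ 2" by (simp add: e)
        \<comment> \<open>Four of the six terms cancel identically; the other two leave the factor \<open>1 - q * y ^ 3\<close>.\<close>
        have "cubic_theta_form q y = a * b * (1 - q * y ^ 3)"
          using q0
          by (simp only: cubic_theta_form_def A0 A1 A2 B0 B1 B2 y2 y4) (simp add: field_simps power_numeral_reduce)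
        thus ?thesis using e by (simp add: F_def)
      next
        case 3
        hence "q ^ 2 * y ^ 3 = 1" using e by simp
        thus ?thesis by (simp add: F_def Theta_1[OF q3])
      qed
    qed auto
  qed
  have G1: "G (- 1) \<noteq> 0" using Theta_nonzero_norm_1[OF q, of "- 1"] by (simp add: G_def)
  have "F (- 1) = qpoch_inf q q * (qpoch_inf (q ^ 3) (q ^ 3)) ^ 2 * G (- 1)"
  proof -
    define c d where "c = Theta (- (q ^ 3)) (q ^ 9)" and "d = Theta (- 1) (q ^ 9)"
    have B2: "Theta (- (q ^ 6)) (q ^ 9) = c"
      unfolding c_def by (rule Theta_reflect_eq[OF q9]) (use q0 in \<open>simp_all add: power_numeral_reduce\<close>)
    have B3: "Theta (- (q ^ 9)) (q ^ 9) = d"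
      unfolding d_def by (rule Theta_reflect_eq[OF q9]) simp_all
    have "cubic_theta_form q (- 1) = qpoch_inf (q ^ 3) (q ^ 3) * (c - q * d)"
      by (simp add: cubic_theta_form_def one Theta_1[OF q9] B2 flip: c_def d_def) (simp add: algebra_simps)
    moreover have "Theta (- q) (q ^ 3) * (c - q * d) = qpoch_inf (q ^ 3) (q ^ 3) * qpoch_inf q q"
    proof -
      have "q ^ 3 * (- q) ^ 3 = - (q ^ 6)" "(q ^ 3) ^ 2 * (- q) ^ 3 = - (q ^ 9)" "(q ^ 3) ^ 3 = q ^ 9"
        by (simp_all add: power_numeral_reduce)
      with quintuple_product[OF q3, of "- q"] show ?thesis
        using q0 by (simp add: B2 B3 Theta_cube_nome[OF q])
    qed
    moreover have "Theta (- (q ^ 2)) (q ^ 3) = Theta (- q) (q ^ 3)"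
      by (rule Theta_reflect_eq[OF q3]) (use q0 in \<open>simp_all add: power_numeral_reduce\<close>)
    ultimately show ?thesis by (simp add: F_def G_def power2_eq_square mult_ac)
  qed
  from quasi_periodic_unique[OF q holF holG mF mG m simple zero _ G1 this u]
  show ?thesis by (simp add: F_def G_def)
qed

section \<open>The sextic theta form\<close>

text \<open>
  Comparing norms gives \<open>a = b\<close>, and then \<open>s = 1\<close>. This separates the zero orbits of different theta
  functions.
\<close>
lemma norm_unit_powi_eq:
  fixes q s :: complex
  assumes q: "0 < norm q" "norm q < 1" and s: "norm s = 1" and e: "s * q powi a = q powi b"
  shows "a = b \<and> s = 1"
proof -
  have q0: "q \<noteq> 0" using q by auto
  have s1: "s = q powi (b - a)" using e q0 by (simp add: power_int_diff field_simps)
  hence "b - a = 0" using s powi_eq_1_norm[OF q] by metis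
  thus ?thesis using s1 by simp
qed

text \<open>
  All zeros of the theta function are powers of its nome, here exponents divisible by \<open>k\<close>.
\<close>
lemma Theta_power_nonzero:
  fixes r s :: complex
  assumes r: "0 < norm r" "norm r < 1" and s: "norm s = 1" and k: "k > 0" "\<not> k dvd a"
  shows "Theta (s * r ^ a) (r ^ k) \<noteq> 0"
proof
  have "s * r ^ a \<noteq> 0" using r s by auto
  moreover assume "Theta (s * r ^ a) (r ^ k) = 0"
  ultimately obtain n where "s * r ^ a = (r ^ k) powi n"
    using Theta_eq_0_iff[OF norm_power_nome[OF r k(1)]] by auto
  hence "s * r powi int a = r powi (int k * n)" by (simp add: power_int_mult)
  hence "int a = int k * n" using norm_unit_powi_eq[OF r s] by blast
  hence "int k dvd int a" by simp
  thus False using k by simp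
qed

lemma Theta_triplication_nome:
  assumes Q: "0 < norm Q" "norm Q < 1" and x: "x \<noteq> 0"
  shows "Theta x Q * qpoch_inf (Q ^ 3) (Q ^ 3) ^ 3
    = qpoch_inf Q Q * (Theta x (Q ^ 3) * Theta (Q * x) (Q ^ 3) * Theta (Q ^ 2 * x) (Q ^ 3))"
proof -
  have Q0: "Q \<noteq> 0" using Q by auto
  have *: "{..<3::nat} = {0, 1, 2}" by auto
  have "qpoch_inf x Q = qpoch_inf x (Q ^ 3) * qpoch_inf (Q * x) (Q ^ 3) * qpoch_inf (Q ^ 2 * x) (Q ^ 3)"
    using qpoch_inf_split[OF Q(2), of 3 x] by (simp add: * mult_ac)
  moreover have "qpoch_inf (Q / x) Q
      = qpoch_inf (Q / x) (Q ^ 3) * qpoch_inf (Q ^ 2 / x) (Q ^ 3) * qpoch_inf (Q ^ 3 / x) (Q ^ 3)"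
    using qpoch_inf_split[OF Q(2), of 3 "Q / x"] by (simp add: * mult_ac power2_eq_square power3_eq_cube)
  moreover have "Q ^ 3 / (Q * x) = Q ^ 2 / x" "Q ^ 3 / (Q ^ 2 * x) = Q / x"
    using Q0 by (simp_all add: power2_eq_square power3_eq_cube)
  ultimately show ?thesis by (simp add: Theta_def power3_eq_cube mult_ac)
qed

text \<open>
  The left-hand side of the fifth identity multiplied by its three denominators.
\<close>
definition sextic_theta_form :: "complex \<Rightarrow> complex \<Rightarrow> complex" where
  "sextic_theta_form q z =
     q * Theta (q ^ 3 * z ^ 2) (q ^ 6) * Theta (z ^ 6) (q ^ 18)
       * Theta (q ^ 2 * z) (q ^ 6) * Theta (q ^ 4 * z) (q ^ 6)
   + z ^ 3 * Theta (q * z ^ 2) (q ^ 6) * Theta (q ^ 12 * z ^ 6) (q ^ 18)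
       * Theta z (q ^ 6) * Theta (q ^ 4 * z) (q ^ 6)
   + z ^ 2 * Theta (q ^ 5 * z ^ 2) (q ^ 6) * Theta (q ^ 6 * z ^ 6) (q ^ 18)
       * Theta z (q ^ 6) * Theta (q ^ 2 * z) (q ^ 6)"

definition sextic_theta_product :: "complex \<Rightarrow> complex \<Rightarrow> complex" where
  "sextic_theta_product q z = z ^ 2 * Theta z (q ^ 2) * Theta (- z) q * Theta (q ^ 3 * z ^ 3) (q ^ 6)"

text \<open>
  The shift permutes the three terms cyclically, which is why the period is \<open>q ^ 2\<close> and not \<open>q ^ 6\<close>.
\<close>
lemma sextic_theta_form_shift:
  assumes q: "0 < norm q" "norm q < 1" and z: "z \<noteq> 0"
  shows "sextic_theta_form q (q ^ 2 * z) = 1 / z ^ 6 * sextic_theta_form q z"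
proof -
  have q0: "q \<noteq> 0" using q by auto
  have q6: "0 < norm (q ^ 6)" "norm (q ^ 6) < 1" by (rule norm_power_nome[OF q]; simp)+
  have q18: "0 < norm (q ^ 18)" "norm (q ^ 18) < 1" by (rule norm_power_nome[OF q]; simp)+
  have h0: "Theta (q ^ 3 * (q ^ 2 * z) ^ 2) (q ^ 6) = - Theta (q * z ^ 2) (q ^ 6) / (q * z ^ 2)"
    by (rule Theta_shift_eq[OF q6]) (use z q0 in \<open>auto simp: power_numeral_reduce\<close>)
  have h1: "Theta (q ^ 5 * (q ^ 2 * z) ^ 2) (q ^ 6) = - Theta (q ^ 3 * z ^ 2) (q ^ 6) / (q ^ 3 * z ^ 2)"
    by (rule Theta_shift_eq[OF q6]) (use z q0 in \<open>auto simp: power_numeral_reduce\<close>)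
  have h2: "Theta (q * (q ^ 2 * z) ^ 2) (q ^ 6) = Theta (q ^ 5 * z ^ 2) (q ^ 6)"
    by (simp add: power_numeral_reduce mult_ac)
  have A0: "Theta ((q ^ 2 * z) ^ 6) (q ^ 18) = Theta (q ^ 12 * z ^ 6) (q ^ 18)"
    by (simp add: power_mult_distrib flip: power_mult)
  have A1: "Theta (q ^ 6 * (q ^ 2 * z) ^ 6) (q ^ 18) = - Theta (z ^ 6) (q ^ 18) / z ^ 6"
    by (rule Theta_shift_eq[OF q18]) (use z q0 in \<open>auto simp: power_numeral_reduce\<close>)
  have A2: "Theta (q ^ 12 * (q ^ 2 * z) ^ 6) (q ^ 18) = - Theta (q ^ 6 * z ^ 6) (q ^ 18) / (q ^ 6 * z ^ 6)"
    by (rule Theta_shift_eq[OF q18]) (use z q0 in \<open>auto simp: power_numeral_reduce\<close>)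
  have t1: "Theta (q ^ 2 * (q ^ 2 * z)) (q ^ 6) = Theta (q ^ 4 * z) (q ^ 6)"
    by (simp add: power_numeral_reduce mult_ac)
  have t2: "Theta (q ^ 4 * (q ^ 2 * z)) (q ^ 6) = - Theta z (q ^ 6) / z"
    by (rule Theta_shift_eq[OF q6]) (use z q0 in \<open>auto simp: power_numeral_reduce\<close>)
  show ?thesis using z q0
    by (simp only: sextic_theta_form_def h0 h1 h2 A0 A1 A2 t1 t2) (simp add: field_simps power_numeral_reduce)
qed

lemma sextic_theta_product_shift:
  assumes q: "0 < norm q" "norm q < 1" and z: "z \<noteq> 0"
  shows "sextic_theta_product q (q ^ 2 * z) = 1 / z ^ 6 * sextic_theta_product q z"
proof -
  have q0: "q \<noteq> 0" using q by auto
  have q2: "0 < norm (q ^ 2)" "norm (q ^ 2) < 1" by (rule norm_power_nome[OF q]; simp)+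
  have q6: "0 < norm (q ^ 6)" "norm (q ^ 6) < 1" by (rule norm_power_nome[OF q]; simp)+
  have 1: "Theta (q ^ 2 * z) (q ^ 2) = - Theta z (q ^ 2) / z"
    by (rule Theta_shift_eq[OF q2]) (use z in auto)
  have 2: "Theta (- (q ^ 2 * z)) q = - Theta (- (q * z)) q / (- (q * z))"
    by (rule Theta_shift_eq[OF q]) (use z q0 in \<open>auto simp: power2_eq_square\<close>)
  have 3: "Theta (- (q * z)) q = - Theta (- z) q / (- z)"
    by (rule Theta_shift_eq[OF q]) (use z q0 in auto)
  have 4: "Theta (q ^ 3 * (q ^ 2 * z) ^ 3) (q ^ 6) = - Theta (q ^ 3 * z ^ 3) (q ^ 6) / (q ^ 3 * z ^ 3)"
    by (rule Theta_shift_eq[OF q6]) (use z q0 in \<open>auto simp: power_numeral_reduce\<close>)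
  show ?thesis using z q0
    by (simp only: sextic_theta_product_def 1 2 3 4) (simp add: field_simps power_numeral_reduce)
qed

text \<open>
  The zeros of the three theta factors have the forms \<open>q powi (2 * n)\<close>, \<open>- (q powi n)\<close> and
  \<open>(q * z) ^ 3 = q powi (6 * n)\<close>. Signs separate the second family from the others, and the parity of the
  exponent separates the first from the third.
\<close>
lemma sextic_theta_product_simple_zeros:
  assumes q: "0 < norm q" "norm q < 1"
  shows "simple_zeros (sextic_theta_product q)"
proof -
  have q0: "q \<noteq> 0" using q by auto
  have q2: "0 < norm (q ^ 2)" "norm (q ^ 2) < 1" by (rule norm_power_nome[OF q]; simp)+
  have q6: "0 < norm (q ^ 6)" "norm (q ^ 6) < 1" by (rule norm_power_nome[OF q]; simp)+
  have plus: "\<exists>n. z = q powi (2 * n)" if "z \<noteq> 0" "Theta z (q ^ 2) = 0" for z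
    using that Theta_eq_0_iff[OF q2, of z] by (auto simp: power_int_mult)
  have minus: "\<exists>n. (- 1) * q powi n = z" if z: "z \<noteq> 0" "Theta (- z) q = 0" for z
  proof -
    obtain n where "- z = q powi n" using z Theta_eq_0_iff[OF q, of "- z"] by auto
    thus ?thesis by (intro exI[of _ n]) (simp flip: minus_equation_iff)
  qed
  have third: "\<exists>n. q ^ 3 * z ^ 3 = q powi (6 * n)" if "z \<noteq> 0" "Theta (q ^ 3 * z ^ 3) (q ^ 6) = 0" for z
    using that q0 Theta_eq_0_iff[OF q6, of "q ^ 3 * z ^ 3"] by (auto simp: power_int_mult)
  have cube: "q ^ 3 * (s * q powi n) ^ 3 = s ^ 3 * q powi (3 + 3 * n)" for s n
    using q0 by (simp add: power_mult_distrib power_int_add power_int_mult mult.commute[of 3])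
  have "simple_zeros (\<lambda>z. z ^ 2)" by (simp add: simple_zeros_def)
  moreover have "simple_zeros (\<lambda>z. Theta z (q ^ 2))" by (rule Theta_simple_zeros[OF q2])
  ultimately have 1: "simple_zeros (\<lambda>z. z ^ 2 * Theta z (q ^ 2))"
    by (intro simple_zeros_mult holomorphic_intros Theta_holomorphic q2) auto
  have "simple_zeros (\<lambda>z. Theta (- z) q)"
    using simple_zeros_monomial[OF Theta_holomorphic[OF q(2)] Theta_simple_zeros[OF q], of "- 1" 1] by simp
  hence 2: "simple_zeros (\<lambda>z. z ^ 2 * Theta z (q ^ 2) * Theta (- z) q)"
  proof (intro simple_zeros_mult[OF _ _ 1] notI)
    fix z assume z: "z \<noteq> 0" "z ^ 2 * Theta z (q ^ 2) = 0" "Theta (- z) q = 0"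
    obtain n where "z = q powi (2 * n)" using plus[of z] z by auto
    moreover obtain k where "(- 1) * q powi k = z" using minus[of z] z by auto
    ultimately show False using norm_unit_powi_eq[OF q, of "- 1" k "2 * n"] by simp
  qed (auto intro!: holomorphic_intros q q2)
  have "simple_zeros (\<lambda>z. Theta (q ^ 3 * z ^ 3) (q ^ 6))"
    using simple_zeros_monomial[OF Theta_holomorphic[OF q6(2)] Theta_simple_zeros[OF q6], of "q ^ 3" 3] q0 by simp
  hence "simple_zeros (\<lambda>z. z ^ 2 * Theta z (q ^ 2) * Theta (- z) q * Theta (q ^ 3 * z ^ 3) (q ^ 6))"
  proof (intro simple_zeros_mult[OF _ _ 2] notI)
    fix z assume z: "z \<noteq> 0" "z ^ 2 * Theta z (q ^ 2) * Theta (- z) q = 0" "Theta (q ^ 3 * z ^ 3) (q ^ 6) = 0"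
    obtain l where l: "q ^ 3 * z ^ 3 = q powi (6 * l)" using third[of z] z by auto
    consider n where "z = q powi (2 * n)" | n where "(- 1) * q powi n = z"
      using plus[of z] minus[of z] z by auto
    thus False
    proof cases
      case 1
      hence "1 * q powi (3 + 3 * (2 * n)) = q powi (6 * l)" using l cube[of 1 "2 * n"] by simp
      hence "3 + 3 * (2 * n) = 6 * l" using norm_unit_powi_eq[OF q, of 1] by auto
      thus False by presburger
    next
      case 2
      hence "(- 1) * q powi (3 + 3 * n) = q powi (6 * l)" using l cube[of "- 1" n] by simp
      thus False using norm_unit_powi_eq[OF q, of "- 1"] by auto
    qed
  qed (auto intro!: holomorphic_intros q q2 q6 simp: q0)
  thus ?thesis unfolding sextic_theta_product_def .
qed

text \<open>
  At \<open>1\<close> every term has a vanishing factor. At the other points one theta of nome \<open>q ^ 18\<close> vanishes, which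
  kills one term, and reflection and inversion make the remaining two terms cancel.
\<close>
lemma sextic_theta_form_zeros:
  assumes q: "0 < norm q" "norm q < 1"
  shows "sextic_theta_form q 1 = 0" "sextic_theta_form q (- 1) = 0"
    and "sextic_theta_form q (- 1 / q) = 0"
    and "v ^ 3 = 1 \<Longrightarrow> sextic_theta_form q (v / q) = 0"
proof -
  have q0: "q \<noteq> 0" using q by auto
  have q6: "0 < norm (q ^ 6)" "norm (q ^ 6) < 1" by (rule norm_power_nome[OF q]; simp)+
  have q18: "0 < norm (q ^ 18)" "norm (q ^ 18) < 1" by (rule norm_power_nome[OF q]; simp)+
  show "sextic_theta_form q 1 = 0"
    by (simp add: sextic_theta_form_def Theta_1[OF q6] Theta_1[OF q18])
  have "Theta (q ^ 12) (q ^ 18) = Theta (q ^ 6) (q ^ 18)"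
    by (rule Theta_reflect_eq[OF q18]) (use q0 in \<open>auto simp flip: power_add\<close>)
  moreover have "Theta (- (q ^ 4)) (q ^ 6) = Theta (- (q ^ 2)) (q ^ 6)"
    by (rule Theta_reflect_eq[OF q6]) (use q0 in \<open>auto simp flip: power_add\<close>)
  moreover have "Theta (q ^ 5) (q ^ 6) = Theta q (q ^ 6)"
    by (rule Theta_reflect_eq[OF q6]) (use q0 in \<open>auto simp flip: power_Suc\<close>)
  ultimately show "sextic_theta_form q (- 1) = 0"
    by (simp add: sextic_theta_form_def Theta_1[OF q18])
  define a where "a = Theta (q ^ 6) (q ^ 18)"
  \<comment> \<open>If \<open>q ^ 6 * y ^ 6 = 1\<close>, the third term vanishes and the other two thetas of nome \<open>q ^ 18\<close> are multiples of \<open>a\<close>.\<close>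
  have common: "sextic_theta_form q y = a * Theta (q ^ 4 * y) (q ^ 6) *
      (y ^ 3 * Theta (q * y ^ 2) (q ^ 6) * Theta y (q ^ 6)
        - Theta (q ^ 3 * y ^ 2) (q ^ 6) * Theta (q ^ 2 * y) (q ^ 6) / q ^ 5)"
    if y: "q ^ 6 * y ^ 6 = 1" for y
  proof -
    have A0: "Theta (y ^ 6) (q ^ 18) = - a / q ^ 6"
      unfolding a_def by (rule Theta_inverse_eq[OF q18]) (use y in simp)
    have "q ^ 12 * y ^ 6 = q ^ 6 * (q ^ 6 * y ^ 6)" by (simp flip: power_add mult.assoc)
    hence A2: "q ^ 12 * y ^ 6 = q ^ 6" by (simp add: y)
    have q6: "q / q ^ 6 = 1 / q ^ 5" using q0 by (simp add: power_numeral_reduce)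
    show ?thesis
      unfolding sextic_theta_form_def A0 A2 y Theta_1[OF q18] a_def[symmetric]
      using q0 by (simp add: field_simps power_numeral_reduce)
  qed
  show "sextic_theta_form q (- 1 / q) = 0"
  proof -
    have "Theta (1 / q) (q ^ 6) = - Theta q (q ^ 6) / q"
      by (rule Theta_inverse_eq[OF q6]) (use q0 in simp)
    moreover have "Theta (- 1 / q) (q ^ 6) = - Theta (- q) (q ^ 6) / (- q)"
      by (rule Theta_inverse_eq[OF q6]) (use q0 in simp)
    moreover have "q * (- 1 / q) ^ 2 = 1 / q" "q ^ 3 * (- 1 / q) ^ 2 = q" "q ^ 2 * (- 1 / q) = - q"
      "(- 1 / q) ^ 3 = - 1 / q ^ 3" "q ^ 6 * (- 1 / q) ^ 6 = 1"
      using q0 by (simp_all add: power_divide power_numeral_reduce)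
    ultimately show ?thesis
      using common[of "- 1 / q"] q0 by (simp add: power_numeral_reduce)
  qed
  show "sextic_theta_form q (v / q) = 0" if v: "v ^ 3 = 1"
  proof -
    have v0: "v \<noteq> 0" using v by auto
    have v2: "v * v ^ 2 = 1" using v by (simp add: power_numeral_reduce)
    have "v ^ 6 = (v ^ 3) ^ 2" by (simp flip: power_mult)
    hence v6: "v ^ 6 = 1" by (simp add: v)
    have 1: "Theta (v ^ 2 / q) (q ^ 6) = - Theta (q * v) (q ^ 6) / (q * v)"
      by (rule Theta_inverse_eq[OF q6]) (use q0 v2 in simp)
    have 2: "Theta (v / q) (q ^ 6) = - Theta (q * v ^ 2) (q ^ 6) / (q * v ^ 2)"
      by (rule Theta_inverse_eq[OF q6]) (use q0 v2 in \<open>simp add: mult.commute\<close>)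
    have e: "q * (v / q) ^ 2 = v ^ 2 / q" "q ^ 3 * (v / q) ^ 2 = q * v ^ 2" "q ^ 2 * (v / q) = q * v"
      "(v / q) ^ 3 = 1 / q ^ 3" "q ^ 6 * (v / q) ^ 6 = 1"
      using q0 by (simp_all add: power_divide v v6) (simp_all add: power_numeral_reduce)
    have "1 / q ^ 3 * (- Theta (q * v) (q ^ 6) / (q * v)) * (- Theta (q * v ^ 2) (q ^ 6) / (q * v ^ 2))
        = Theta (q * v) (q ^ 6) * Theta (q * v ^ 2) (q ^ 6) / (q ^ 5 * (v * v ^ 2))"
      by (simp add: power_numeral_reduce mult_ac)
    thus ?thesis
      using common[of "v / q"] by (simp only: e 1 2 v2) simp
  qed
qed

text \<open>
  The point \<open>1 / r ^ 3\<close> annihilates the first term of the form and is not a zero of the product. The other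
  two terms add up to \<open>Theta (r ^ 5) (r ^ 12) + r * Theta r (r ^ 12)\<close> times common factors, and this sum
  is the quintuple product for nome \<open>r ^ 4\<close> at \<open>1 / r\<close>. What remains is an identity of infinite products.
\<close>
lemma sextic_theta_constant:
  assumes r: "0 < norm r" "norm r < 1"
  shows "sextic_theta_product (r ^ 2) (1 / r ^ 3) \<noteq> 0"
    and "qpoch_inf (r ^ 2) (r ^ 2) * sextic_theta_form (r ^ 2) (1 / r ^ 3)
      = qpoch_inf (r ^ 4) (r ^ 4) * Theta (r ^ 6) (r ^ 36) * sextic_theta_product (r ^ 2) (1 / r ^ 3)"
proof -
  have r0: "r \<noteq> 0" using r by auto
  have r2: "0 < norm (r ^ 2)" "norm (r ^ 2) < 1" by (rule norm_power_nome[OF r]; simp)+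
  have r4: "0 < norm (r ^ 4)" "norm (r ^ 4) < 1" by (rule norm_power_nome[OF r]; simp)+
  have r12: "0 < norm (r ^ 12)" "norm (r ^ 12) < 1" by (rule norm_power_nome[OF r]; simp)+
  have r36: "0 < norm (r ^ 36)" "norm (r ^ 36) < 1" by (rule norm_power_nome[OF r]; simp)+
  define p g where "p = qpoch_inf (r ^ 4) (r ^ 4)" and "g = Theta (r ^ 6) (r ^ 36)"
  define a b c where "a = Theta r (r ^ 12)" and "b = Theta (r ^ 3) (r ^ 12)" and "c = Theta (r ^ 5) (r ^ 12)"
  define d e where "d = Theta r (r ^ 4)" and "e = Theta (- r) (r ^ 2)"
  let ?z = "1 / r ^ 3"
  have nome: "(r ^ 2) ^ 6 = r ^ 12" "(r ^ 2) ^ 18 = r ^ 36" "(r ^ 2) ^ 2 = r ^ 4"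
    by (simp_all flip: power_mult)
  have p12: "Theta (r ^ 4) (r ^ 12) = p"
    using Theta_cube_nome(1)[OF r4] by (simp add: p_def flip: power_mult)
  have form: "sextic_theta_form (r ^ 2) ?z = p * g * b * (c + r * a) / r ^ 16"
  proof -
    have "(r ^ 2) ^ 3 * ?z ^ 2 = 1" using r0 by (simp add: power_divide flip: power_mult)
    hence h0: "Theta ((r ^ 2) ^ 3 * ?z ^ 2) (r ^ 12) = 0" by (simp add: Theta_1[OF r12])
    have h2: "Theta (r ^ 2 * ?z ^ 2) (r ^ 12) = - p / r ^ 4"
      unfolding p12[symmetric]
      by (rule Theta_inverse_eq[OF r12]) (use r0 in \<open>simp add: power_divide flip: power_mult power_add\<close>)
    have "(r ^ 2) ^ 12 * ?z ^ 6 = r ^ 6" using r0 by (simp add: power_divide field_simps flip: power_mult power_add)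
    hence A2: "Theta ((r ^ 2) ^ 12 * ?z ^ 6) (r ^ 36) = g" by (simp add: g_def)
    have t0: "Theta ?z (r ^ 12) = - b / r ^ 3"
      unfolding b_def by (rule Theta_inverse_eq[OF r12]) (use r0 in simp)
    have "(r ^ 2) ^ 4 * ?z = r ^ 5" using r0 by (simp add: field_simps flip: power_mult power_add)
    hence t2: "Theta ((r ^ 2) ^ 4 * ?z) (r ^ 12) = c" by (simp add: c_def)
    have "(r ^ 2) ^ 5 * ?z ^ 2 = r ^ 4" using r0 by (simp add: power_divide field_simps flip: power_mult power_add)
    hence h1: "Theta ((r ^ 2) ^ 5 * ?z ^ 2) (r ^ 12) = p" by (simp add: p12)
    have A1: "Theta (r ^ 12 * ?z ^ 6) (r ^ 36) = - g / r ^ 6"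
      unfolding g_def
      by (rule Theta_inverse_eq[OF r36]) (use r0 in \<open>simp add: power_divide field_simps flip: power_mult power_add\<close>)
    have "(r ^ 2) ^ 2 * ?z = r" using r0 by (simp add: power_numeral_reduce)
    hence t1: "Theta ((r ^ 2) ^ 2 * ?z) (r ^ 12) = a" by (simp add: a_def)
    show ?thesis
      unfolding sextic_theta_form_def nome(1,2) h0 h1 h2 t0 t1 t2 A1 A2
      using r0 by (simp add: power_divide) (simp add: field_simps power_numeral_reduce)
  qed
  have prod: "sextic_theta_product (r ^ 2) ?z = d * e * b / r ^ 16"
  proof -
    have "Theta ?z (r ^ 4) = - Theta (r ^ 3) (r ^ 4) / r ^ 3"
      by (rule Theta_inverse_eq[OF r4]) (use r0 in simp)
    moreover have "Theta (r ^ 3) (r ^ 4) = d"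
      unfolding d_def by (rule Theta_reflect_eq[OF r4]) (use r0 in \<open>auto simp: power_numeral_reduce\<close>)
    ultimately have 1: "Theta ?z (r ^ 4) = - d / r ^ 3" by simp
    have "Theta (- ?z) (r ^ 2) = - Theta (- (r ^ 3)) (r ^ 2) / (- (r ^ 3))"
      by (rule Theta_inverse_eq[OF r2]) (use r0 in simp)
    moreover have "Theta (- (r ^ 3)) (r ^ 2) = - e / (- r)"
      unfolding e_def by (rule Theta_shift_eq[OF r2]) (use r0 in \<open>auto simp: power_numeral_reduce\<close>)
    ultimately have 2: "Theta (- ?z) (r ^ 2) = e / r ^ 4" using r0 by (simp add: power_numeral_reduce)
    have 3: "Theta ((r ^ 2) ^ 3 * ?z ^ 3) (r ^ 12) = - b / r ^ 3"
      unfolding b_def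
      by (rule Theta_inverse_eq[OF r12]) (use r0 in \<open>simp add: power_divide field_simps flip: power_mult power_add\<close>)
    show ?thesis
      unfolding sextic_theta_product_def nome 1 2 3
      using r0 by (simp add: power_divide)
  qed
  have d0: "d \<noteq> 0" using Theta_power_nonzero[OF r, of 1 4 1] by (simp add: d_def)
  have e0: "e \<noteq> 0" using Theta_power_nonzero[OF r, of "- 1" 2 1] by (simp add: e_def)
  have b0: "b \<noteq> 0" using Theta_power_nonzero[OF r, of 1 12 3] by (simp add: b_def)
  show "sextic_theta_product (r ^ 2) ?z \<noteq> 0" using prod d0 e0 b0 r0 by simp
  have E: "d * (c + r * a) = p * Theta (r ^ 2) (r ^ 4)"
  proof -
    have 1: "Theta (1 / r) (r ^ 4) = - d / r"
      unfolding d_def by (rule Theta_inverse_eq[OF r4]) (use r0 in simp)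
    have 2: "Theta ((1 / r) ^ 2) (r ^ 4) = - Theta (r ^ 2) (r ^ 4) / r ^ 2"
      by (rule Theta_inverse_eq[OF r4]) (use r0 in \<open>simp add: power_divide\<close>)
    have 3: "r ^ 4 * (1 / r) ^ 3 = r" "(r ^ 4) ^ 2 * (1 / r) ^ 3 = r ^ 5" "(r ^ 4) ^ 3 = r ^ 12"
      using r0 by (simp_all add: power_divide field_simps flip: power_mult power_add power_Suc)
    have "(- d / r) * (a + 1 / r * c) = p * (- Theta (r ^ 2) (r ^ 4) / r ^ 2)"
      using quintuple_product[OF r4, of "1 / r"] r0
      unfolding 1 2 3 a_def[symmetric] c_def[symmetric] p_def[symmetric] by simp
    thus ?thesis using r0 by (simp add: field_simps power_numeral_reduce)
  qed
  have D: "d = qpoch_inf r (r ^ 2) * p"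
  proof -
    have "{..<2::nat} = {0, 1}" by auto
    moreover have "r ^ 2 * r = r ^ 3" "r ^ 4 / r = r ^ 3" using r0 by (simp_all add: power_numeral_reduce)
    ultimately show ?thesis
      using qpoch_inf_split[OF r2(2), of 2 r] by (simp add: d_def p_def Theta_def flip: power_mult)
  qed
  have "r ^ 4 / r ^ 2 = r ^ 2" using r0 by (simp add: power_numeral_reduce)
  moreover have "qpoch_inf (r ^ 2) (r ^ 4) = qpoch_inf r (r ^ 2) * qpoch_inf (- r) (r ^ 2)"
    using qpoch_inf_square[OF r2(2), of r] by (simp flip: power_mult)
  ultimately have T2: "Theta (r ^ 2) (r ^ 4) = (qpoch_inf r (r ^ 2) * qpoch_inf (- r) (r ^ 2)) ^ 2 * p"
    by (simp add: Theta_def p_def power2_eq_square)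
  have "r ^ 2 / (- r) = - r" using r0 by (simp add: power2_eq_square)
  hence e: "e = qpoch_inf (- r) (r ^ 2) ^ 2 * qpoch_inf (r ^ 2) (r ^ 2)"
    by (simp add: e_def Theta_def power2_eq_square)
  have "d * (qpoch_inf (r ^ 2) (r ^ 2) * (c + r * a)) = qpoch_inf (r ^ 2) (r ^ 2) * (d * (c + r * a))"
    by (simp only: mult_ac)
  also have "\<dots> = d * (d * e)"
    unfolding E by (simp only: T2 D e) (simp add: power2_eq_square mult_ac)
  finally have "d * (qpoch_inf (r ^ 2) (r ^ 2) * (c + r * a)) = d * (d * e)" .
  hence "qpoch_inf (r ^ 2) (r ^ 2) * (c + r * a) = d * e" using d0 by simp
  moreover have "qpoch_inf (r ^ 2) (r ^ 2) * sextic_theta_form (r ^ 2) ?z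
      = p * g * b * (qpoch_inf (r ^ 2) (r ^ 2) * (c + r * a)) / r ^ 16"
    by (simp add: form)
  ultimately show "qpoch_inf (r ^ 2) (r ^ 2) * sextic_theta_form (r ^ 2) ?z
      = qpoch_inf (r ^ 4) (r ^ 4) * Theta (r ^ 6) (r ^ 36) * sextic_theta_product (r ^ 2) ?z"
    by (simp add: prod flip: p_def g_def)
qed

text \<open>
  The comparison is made with nome \<open>q ^ 2\<close>. Each zero of the product is moved along its orbit to one of
  the points \<open>1\<close>, \<open>-1\<close>, \<open>-1 / q\<close> or \<open>v / q\<close> with \<open>v ^ 3 = 1\<close>, where the form is known to vanish.
\<close>
theorem sextic_theta_form_eq_product:
  assumes q: "0 < norm q" "norm q < 1" and z: "z \<noteq> 0"
  shows "qpoch_inf q q * sextic_theta_form q z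
    = qpoch_inf (q ^ 2) (q ^ 2) * Theta (q ^ 3) (q ^ 18) * sextic_theta_product q z"
proof -
  have q0: "q \<noteq> 0" using q by auto
  have q2: "0 < norm (q ^ 2)" "norm (q ^ 2) < 1" by (rule norm_power_nome[OF q]; simp)+
  have q6: "0 < norm (q ^ 6)" "norm (q ^ 6) < 1" by (rule norm_power_nome[OF q]; simp)+
  have q18: "0 < norm (q ^ 18)" "norm (q ^ 18) < 1" by (rule norm_power_nome[OF q]; simp)+
  define F where "F = (\<lambda>z. qpoch_inf q q * sextic_theta_form q z)"
  define m where "m = (\<lambda>z::complex. 1 / z ^ 6)"
  have m: "m z \<noteq> 0" if "z \<noteq> 0" for z using that by (simp add: m_def)
  have mF: "F (q ^ 2 * z) = m z * F z" if "z \<noteq> 0" for z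
    using sextic_theta_form_shift[OF q that] by (simp add: F_def m_def)
  have mG: "sextic_theta_product q (q ^ 2 * z) = m z * sextic_theta_product q z" if "z \<noteq> 0" for z
    using sextic_theta_product_shift[OF q that] by (simp add: m_def)
  have holF: "F holomorphic_on - {0}"
    unfolding F_def sextic_theta_form_def by (intro holomorphic_intros q6 q18) (auto simp: q0)
  have holG: "sextic_theta_product q holomorphic_on - {0}"
    unfolding sextic_theta_product_def by (intro holomorphic_intros q q2 q6) (auto simp: q0)
  have orbit: "F z = 0" if "z = (q ^ 2) powi n * y" "y \<noteq> 0" "F y = 0" for z y n
    using orbit_invariant[of "q ^ 2" "\<lambda>z. F z = 0" y n] that q0 by (simp add: mF m)
  have zero: "F z = 0" if z: "z \<noteq> 0" and G: "sextic_theta_product q z = 0" for z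
  proof -
    consider "Theta z (q ^ 2) = 0" | "Theta (- z) q = 0" | "Theta (q ^ 3 * z ^ 3) (q ^ 6) = 0"
      using G z by (auto simp: sextic_theta_product_def)
    thus ?thesis
    proof cases
      case 1
      then obtain n where "z = (q ^ 2) powi n * 1" using Theta_eq_0_iff[OF q2 z] by auto
      thus ?thesis by (rule orbit) (simp_all add: F_def sextic_theta_form_zeros[OF q])
    next
      case 2
      then obtain n where n: "- z = q powi n" using Theta_eq_0_iff[OF q, of "- z"] z by auto
      have "z ^ 2 = (- z) ^ 2" by simp
      also have "\<dots> = (q ^ 2) powi n" unfolding n by (simp add: power2_eq_square power_int_mult_distrib)
      finally have z2: "z ^ 2 = (q ^ 2) powi n" .
      show ?thesis
      proof (rule vanish_on_power_orbit[where F = F and m = m and k = 2, OF q2(1) mF m _ _ z z2])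
        fix y :: complex and j :: nat
        assume y: "y \<noteq> 0" "j < 2" and e: "(q ^ 2) ^ j * y ^ 2 = 1"
        have "((q ^ j) * y) ^ 2 = 1" using e by (simp add: power_mult_distrib mult.commute flip: power_mult)
        hence "q ^ j * y = 1 \<or> q ^ j * y = - 1" by (simp add: power2_eq_1_iff)
        moreover have "j = 0 \<or> j = 1" using y by linarith
        ultimately have "y = 1 \<or> y = - 1 \<or> y = 1 / q \<or> y = - 1 / q"
          using q0 by (auto simp: field_simps)
        thus "F y = 0"
          using sextic_theta_form_zeros(1-3)[OF q] sextic_theta_form_zeros(4)[OF q, of 1]
          by (auto simp: F_def)
      qed auto
    next
      case 3
      then obtain n where n: "q ^ 3 * z ^ 3 = (q ^ 6) powi n"
        using Theta_eq_0_iff[OF q6, of "q ^ 3 * z ^ 3"] z q0 by auto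
      define v where "v = q * ((q ^ 2) powi (- n) * z)"
      have "v ^ 3 = (q ^ 3 * z ^ 3) * ((q ^ 2) powi (- n)) ^ 3"
        by (simp add: v_def power_mult_distrib mult_ac)
      also have "((q ^ 2) powi (- n)) ^ 3 = ((q ^ 2) ^ 3) powi (- n)"
        by (simp add: power3_eq_cube flip: power_int_mult_distrib)
      also have "(q ^ 2) ^ 3 = q ^ 6" by (simp flip: power_mult)
      also have "q ^ 3 * z ^ 3 * (q ^ 6) powi (- n) = 1"
        unfolding n using q0 by (simp add: power_int_minus)
      finally have v: "v ^ 3 = 1" .
      hence v0: "v \<noteq> 0" by auto
      have "z = (q ^ 2) powi n * (v / q)" using q0 by (simp add: v_def power_int_minus)
      thus ?thesis
        by (rule orbit) (use v0 q0 in \<open>simp_all add: F_def sextic_theta_form_zeros(4)[OF q v]\<close>)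
    qed
  qed
  define r where "r = csqrt q"
  have rq: "r ^ 2 = q" by (simp add: r_def)
  have r: "0 < norm r" "norm r < 1"
    using q rq by (auto simp: r_def)
  have pw: "r ^ 4 = q ^ 2" "r ^ 6 = q ^ 3" "r ^ 36 = q ^ 18" by (simp_all flip: rq power_mult)
  note const = sextic_theta_constant[OF r, unfolded rq pw]
  have r3: "1 / r ^ 3 \<noteq> 0" using r by auto
  have "F (1 / r ^ 3) = (qpoch_inf (q ^ 2) (q ^ 2) * Theta (q ^ 3) (q ^ 18))
      * sextic_theta_product q (1 / r ^ 3)"
    unfolding F_def by (rule const(2))
  from quasi_periodic_unique[where F = F and G = "sextic_theta_product q" and m = m,
          OF q2 holF holG mF mG m sextic_theta_product_simple_zeros[OF q] zero r3 const(1) this z]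
  show ?thesis unfolding F_def .
qed

section \<open>The five identities\<close>

lemma Theta_inverse_power:
  assumes "0 < norm Q" "norm Q < 1" "x \<noteq> 0"
  shows "Theta ((1 / x) ^ k) Q = - Theta (x ^ k) Q / x ^ k"
  by (rule Theta_inverse_eq[OF assms(1,2)]) (use assms in \<open>simp add: power_divide\<close>)

lemma Theta_reflect_power:
  assumes "0 < norm q" "norm q < 1" "x \<noteq> 0" "c > 0" "a + b = c"
  shows "Theta (q ^ a * (1 / x) ^ k) (q ^ c) = Theta (q ^ b * x ^ k) (q ^ c)"
proof (rule Theta_reflect_eq[OF norm_power_nome[OF assms(1,2,4)]])
  show "q ^ b * x ^ k \<noteq> 0" using assms by auto
  show "q ^ b * x ^ k * (q ^ a * (1 / x) ^ k) = q ^ c"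
    using assms(3) by (simp add: power_divide power_add flip: assms(5))
qed

text \<open>
  The quintuple product identity with nome \<open>q ^ 3\<close> at \<open>z\<close>, \<open>q * z\<close> and \<open>q ^ 2 * z\<close>, with all arguments
  shifted back to the three basic thetas of \<open>z ^ 3\<close>.
\<close>
lemma quintuple_quotients:
  assumes q: "0 < norm q" "norm q < 1" and z: "z \<noteq> 0"
  defines "k \<equiv> qpoch_inf (q ^ 3) (q ^ 3)"
  shows "Theta z (q ^ 3) \<noteq> 0 \<Longrightarrow> Theta (z ^ 2) (q ^ 3) / Theta z (q ^ 3)
      = (Theta (q ^ 3 * z ^ 3) (q ^ 9) + z * Theta (q ^ 6 * z ^ 3) (q ^ 9)) / k"
    and "Theta (q * z) (q ^ 3) \<noteq> 0 \<Longrightarrow> Theta (q ^ 2 * z ^ 2) (q ^ 3) / Theta (q * z) (q ^ 3)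
      = (Theta (q ^ 6 * z ^ 3) (q ^ 9) - q / z ^ 2 * Theta (z ^ 3) (q ^ 9)) / k"
    and "Theta (q ^ 2 * z) (q ^ 3) \<noteq> 0 \<Longrightarrow> Theta (q * z ^ 2) (q ^ 3) / Theta (q ^ 2 * z) (q ^ 3)
      = (Theta (q ^ 3 * z ^ 3) (q ^ 9) + q / z * Theta (z ^ 3) (q ^ 9)) / k"
proof -
  have q0: "q \<noteq> 0" using q by auto
  have q3: "0 < norm (q ^ 3)" "norm (q ^ 3) < 1" by (rule norm_power_nome[OF q]; simp)+
  have q9: "0 < norm (q ^ 9)" "norm (q ^ 9) < 1" by (rule norm_power_nome[OF q]; simp)+
  have k0: "k \<noteq> 0" unfolding k_def by (rule qpoch_inf_self_nonzero[OF q3(2)])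
  have quintuple: "Theta x (q ^ 3) * (Theta (q ^ 3 * x ^ 3) (q ^ 9) + x * Theta (q ^ 6 * x ^ 3) (q ^ 9))
      = k * Theta (x ^ 2) (q ^ 3)" if "x \<noteq> 0" for x
    using quintuple_product[OF q3 that] by (simp add: k_def flip: power_mult)
  show "Theta (z ^ 2) (q ^ 3) / Theta z (q ^ 3)
      = (Theta (q ^ 3 * z ^ 3) (q ^ 9) + z * Theta (q ^ 6 * z ^ 3) (q ^ 9)) / k"
    if "Theta z (q ^ 3) \<noteq> 0"
    using quintuple[OF z] that k0 by (simp add: frac_eq_eq mult_ac)
  have B3: "Theta (q ^ 9 * z ^ 3) (q ^ 9) = - Theta (z ^ 3) (q ^ 9) / z ^ 3"
    by (rule Theta_shift_eq[OF q9]) (use z in auto)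
  have B4: "Theta (q ^ 12 * z ^ 3) (q ^ 9) = - Theta (q ^ 3 * z ^ 3) (q ^ 9) / (q ^ 3 * z ^ 3)"
    by (rule Theta_shift_eq[OF q9]) (use z q0 in \<open>auto simp: power_numeral_reduce\<close>)
  show "Theta (q ^ 2 * z ^ 2) (q ^ 3) / Theta (q * z) (q ^ 3)
      = (Theta (q ^ 6 * z ^ 3) (q ^ 9) - q / z ^ 2 * Theta (z ^ 3) (q ^ 9)) / k"
    if "Theta (q * z) (q ^ 3) \<noteq> 0"
  proof -
    have e: "q ^ 3 * (q * z) ^ 3 = q ^ 6 * z ^ 3" "q ^ 6 * (q * z) ^ 3 = q ^ 9 * z ^ 3"
      "(q * z) ^ 2 = q ^ 2 * z ^ 2"
      by (simp_all add: power_mult_distrib flip: power_add mult.assoc)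
    have "q * z * (- Theta (z ^ 3) (q ^ 9) / z ^ 3) = - (q / z ^ 2 * Theta (z ^ 3) (q ^ 9))"
      using z by (simp add: field_simps power_numeral_reduce)
    hence "Theta (q * z) (q ^ 3) * (Theta (q ^ 6 * z ^ 3) (q ^ 9) - q / z ^ 2 * Theta (z ^ 3) (q ^ 9))
        = k * Theta (q ^ 2 * z ^ 2) (q ^ 3)"
      using quintuple[of "q * z"] q0 z unfolding e B3 by simp
    thus ?thesis using that k0 by (simp add: frac_eq_eq mult_ac)
  qed
  show "Theta (q * z ^ 2) (q ^ 3) / Theta (q ^ 2 * z) (q ^ 3)
      = (Theta (q ^ 3 * z ^ 3) (q ^ 9) + q / z * Theta (z ^ 3) (q ^ 9)) / k"
    if "Theta (q ^ 2 * z) (q ^ 3) \<noteq> 0"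
  proof -
    have e: "q ^ 3 * (q ^ 2 * z) ^ 3 = q ^ 9 * z ^ 3" "q ^ 6 * (q ^ 2 * z) ^ 3 = q ^ 12 * z ^ 3"
      by (simp_all add: power_mult_distrib flip: power_add power_mult mult.assoc)
    have T: "Theta ((q ^ 2 * z) ^ 2) (q ^ 3) = - Theta (q * z ^ 2) (q ^ 3) / (q * z ^ 2)"
      by (rule Theta_shift_eq[OF q3]) (use z q0 in \<open>auto simp: power_numeral_reduce\<close>)
    have "q ^ 2 * z \<noteq> 0" using z q0 by simp
    note base = quintuple[OF this, unfolded e B3 B4 T]
    have "- (q * z ^ 2) * (- Theta (z ^ 3) (q ^ 9) / z ^ 3
          + q ^ 2 * z * (- Theta (q ^ 3 * z ^ 3) (q ^ 9) / (q ^ 3 * z ^ 3)))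
        = Theta (q ^ 3 * z ^ 3) (q ^ 9) + q / z * Theta (z ^ 3) (q ^ 9)"
      using z q0 by (simp add: divide_simps) (simp add: algebra_simps power_numeral_reduce)
    moreover have "Theta (q ^ 2 * z) (q ^ 3) * (- (q * z ^ 2) * (- Theta (z ^ 3) (q ^ 9) / z ^ 3
          + q ^ 2 * z * (- Theta (q ^ 3 * z ^ 3) (q ^ 9) / (q ^ 3 * z ^ 3))))
        = - (q * z ^ 2) * (k * (- Theta (q * z ^ 2) (q ^ 3) / (q * z ^ 2)))"
      by (subst mult.left_commute) (simp only: base)
    ultimately have "Theta (q ^ 2 * z) (q ^ 3) * (Theta (q ^ 3 * z ^ 3) (q ^ 9) + q / z * Theta (z ^ 3) (q ^ 9))
        = k * Theta (q * z ^ 2) (q ^ 3)"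
      using z q0 by simp
    thus ?thesis using that k0 by (simp add: frac_eq_eq mult_ac)
  qed
qed

text \<open>
  Substituting \<open>1 / z\<close> in the first identity and using the inversion formula gives an equation of the
  following form, with \<open>a, b, \<dots>\<close> for theta values; multiplication by \<open>z ^ 6\<close> clears the negative powers.
\<close>
lemma inverse_substitution_in_cubic:
  fixes z :: complex
  assumes z: "z \<noteq> 0"
  shows "z ^ 6 * (1 / z * ((- a / z ^ 2) * b / (- c / z)) + q * (d * (- e / z ^ 6) / f) + (1 / z) ^ 3 * g)
      = z ^ 4 * (a * b / c) + z ^ 3 * g - q * (d * e / f)"
    and "z ^ 6 * (1 / z * k * l * (- a / z ^ 3) / ((- b / z) * c)) = z ^ 3 * k * l * a / (b * c)"
proof -
  have 1: "(- a / z ^ 2) * b / (- c / z) = a * b / c / z"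
    using z by (simp add: power2_eq_square)
  have 2: "z ^ 6 * (1 / z * (x / z)) = z ^ 4 * x" "z ^ 6 * ((1 / z) ^ 3 * x) = z ^ 3 * x" for x
    using z by (simp_all add: power_numeral_reduce)
  have 3: "z ^ 6 * (q * (d * (- e / z ^ 6) / f)) = - (q * (d * e / f))"
    using z by simp
  show "z ^ 6 * (1 / z * ((- a / z ^ 2) * b / (- c / z)) + q * (d * (- e / z ^ 6) / f) + (1 / z) ^ 3 * g)
      = z ^ 4 * (a * b / c) + z ^ 3 * g - q * (d * e / f)"
    unfolding 1 distrib_left 2 3 by simp
  have 4: "1 / z * k * l * (- a / z ^ 3) / ((- b / z) * c) = (k * l * a / (b * c)) / z ^ 3"
    using z by simp
  show "z ^ 6 * (1 / z * k * l * (- a / z ^ 3) / ((- b / z) * c)) = z ^ 3 * k * l * a / (b * c)"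
    unfolding 4 using z by (simp add: power_numeral_reduce)
qed

text \<open>
  The analogue for the third identity, with the factor \<open>u ^ 4\<close>.
\<close>
lemma inverse_substitution_in_cubic_dual:
  fixes u :: complex
  assumes u: "u \<noteq> 0"
  shows "u ^ 4 * ((- a / u ^ 4) * b / (- c / u ^ 2) + 1 / u * q * (d * (- e / u ^ 3) / f) + 1 / u * g)
      = u ^ 2 * (a * b / c) + u ^ 3 * g - q * (d * e / f)"
    and "u ^ 4 * (k * l / ((- b / u) * c) * (- a / u ^ 3)) = u ^ 2 * k * l * a / (b * c)"
proof -
  have 1: "(- a / u ^ 4) * b / (- c / u ^ 2) = a * b / c / u ^ 2"
    using u by (simp add: power_numeral_reduce)
  have 2: "u ^ 4 * (x / u ^ 2) = u ^ 2 * x" "u ^ 4 * (1 / u * x) = u ^ 3 * x" for x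
    using u by (simp_all add: power_numeral_reduce)
  have 3: "u ^ 4 * (1 / u * q * (d * (- e / u ^ 3) / f)) = - (q * (d * e / f))"
    using u by (simp add: power_numeral_reduce)
  show "u ^ 4 * ((- a / u ^ 4) * b / (- c / u ^ 2) + 1 / u * q * (d * (- e / u ^ 3) / f) + 1 / u * g)
      = u ^ 2 * (a * b / c) + u ^ 3 * g - q * (d * e / f)"
    unfolding 1 distrib_left 3 2 by simp
  have 4: "k * l / ((- b / u) * c) * (- a / u ^ 3) = (k * l * a / (b * c)) / u ^ 2"
    using u by (simp add: power_numeral_reduce mult_ac)
  show "u ^ 4 * (k * l / ((- b / u) * c) * (- a / u ^ 3)) = u ^ 2 * k * l * a / (b * c)"
    unfolding 4 using u by (simp add: power_numeral_reduce)
qed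

context
  fixes q :: complex
  assumes q: "0 < norm q" "norm q < 1"
begin

text \<open>
  The quotients are functions of \<open>z\<close> and the remaining thetas functions of \<open>z ^ 2\<close>; expanding the
  quotients produces \<open>z * cubic_theta_form q z\<close>.
\<close>
lemma cubic_identity:
  assumes z: "z \<noteq> 0" and nz: "Theta z (q ^ 3) \<noteq> 0" "Theta (q * z) (q ^ 3) \<noteq> 0" "Theta (q ^ 2 * z) (q ^ 3) \<noteq> 0"
    "Theta z q \<noteq> 0" "Theta (q ^ 2 * z ^ 3) (q ^ 3) \<noteq> 0"
  shows "z * (Theta (z^2) (q^3) * Theta (q^3 * z^6) (q^9) / Theta z (q^3))
       + q * (Theta (q^2 * z^2) (q^3) * Theta (z^6) (q^9) / Theta (q * z) (q^3))
       + z^3 * (Theta (q * z^2) (q^3) * Theta (q^6 * z^6) (q^9) / Theta (q^2 * z) (q^3))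
       = z * qpoch_inf q q * qpoch_inf (q^3) (q^3) * Theta (z^3) q
         / (Theta z q * Theta (q^2 * z^3) (q^3))" (is "?L = ?R")
proof -
  define k where "k = qpoch_inf (q ^ 3) (q ^ 3)"
  have k0: "k \<noteq> 0" unfolding k_def by (rule qpoch_inf_self_nonzero) (use norm_power_nome[OF q] in simp)
  note f = quintuple_quotients[OF q z, folded k_def]
  have "?L = z * (Theta (z^2) (q^3) / Theta z (q^3)) * Theta (q^3 * z^6) (q^9)
      + q * (Theta (q^2 * z^2) (q^3) / Theta (q * z) (q^3)) * Theta (z^6) (q^9)
      + z^3 * (Theta (q * z^2) (q^3) / Theta (q^2 * z) (q^3)) * Theta (q^6 * z^6) (q^9)"
    by (simp add: mult.assoc)
  also have "\<dots> = z * cubic_theta_form q z / k"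
    unfolding f(1)[OF nz(1)] f(2)[OF nz(2)] f(3)[OF nz(3)] cubic_theta_form_def
    using z k0 by (simp add: divide_simps) (simp add: algebra_simps power_numeral_reduce)
  also have "cubic_theta_form q z = qpoch_inf q q * k ^ 2 * Theta (z ^ 3) q / (Theta z q * Theta (q^2 * z^3) (q^3))"
    using cubic_theta_form_product[OF q z] nz(4,5) by (simp add: k_def eq_divide_eq mult_ac)
  also have "z * (qpoch_inf q q * k ^ 2 * Theta (z ^ 3) q / (Theta z q * Theta (q^2 * z^3) (q^3))) / k = ?R"
    using k0 by (simp add: power2_eq_square flip: k_def)
  finally show ?thesis .
qed

text \<open>
  Here the quotients are functions of \<open>u ^ 2\<close> and the remaining thetas functions of \<open>u\<close>; expanding the
  quotients produces the defining expression of \<open>cubic_theta_form\<close>.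
\<close>
lemma cubic_identity_dual:
  assumes u: "u \<noteq> 0" and nz: "Theta (u^2) (q ^ 3) \<noteq> 0" "Theta (q * u^2) (q ^ 3) \<noteq> 0" "Theta (q ^ 2 * u^2) (q ^ 3) \<noteq> 0"
    "Theta u q \<noteq> 0" "Theta (q ^ 2 * u ^ 3) (q ^ 3) \<noteq> 0"
  shows "Theta (u^4) (q^3) * Theta (q^3 * u^3) (q^9) / Theta (u^2) (q^3)
       + u * q * (Theta (q^2 * u^4) (q^3) * Theta (u^3) (q^9) / Theta (q * u^2) (q^3))
       + u * (Theta (q * u^4) (q^3) * Theta (q^6 * u^3) (q^9) / Theta (q^2 * u^2) (q^3))
       = qpoch_inf q q * qpoch_inf (q^3) (q^3)
         / (Theta u q * Theta (q^2 * u^3) (q^3)) * Theta (u^3) q" (is "?L = ?R")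
proof -
  define k where "k = qpoch_inf (q ^ 3) (q ^ 3)"
  have k0: "k \<noteq> 0" unfolding k_def by (rule qpoch_inf_self_nonzero) (use norm_power_nome[OF q] in simp)
  have pw: "(u ^ 2) ^ 2 = u ^ 4" "(u ^ 2) ^ 3 = u ^ 6" by (simp_all flip: power_mult)
  have u2: "u ^ 2 \<noteq> 0" using u by simp
  note f = quintuple_quotients[OF q u2, folded k_def, unfolded pw]
  have "?L = (Theta (u^4) (q^3) / Theta (u^2) (q^3)) * Theta (q^3 * u^3) (q^9)
      + u * q * (Theta (q^2 * u^4) (q^3) / Theta (q * u^2) (q^3)) * Theta (u^3) (q^9)
      + u * (Theta (q * u^4) (q^3) / Theta (q^2 * u^2) (q^3)) * Theta (q^6 * u^3) (q^9)"
    by (simp add: mult.assoc)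
  also have "\<dots> = cubic_theta_form q u / k"
    unfolding f(1)[OF nz(1)] f(2)[OF nz(2)] f(3)[OF nz(3)] cubic_theta_form_def
    using k0 by (simp add: add_divide_distrib distrib_left mult_ac)
  also have "cubic_theta_form q u = qpoch_inf q q * k ^ 2 * Theta (u ^ 3) q / (Theta u q * Theta (q^2 * u^3) (q^3))"
    using cubic_theta_form_product[OF q u] nz(4,5) by (simp add: k_def eq_divide_eq mult_ac)
  also have "qpoch_inf q q * k ^ 2 * Theta (u ^ 3) q / (Theta u q * Theta (q^2 * u^3) (q^3)) / k = ?R"
    using k0 by (simp add: power2_eq_square flip: k_def)
  finally show ?thesis .
qed

lemma cubic_identity_inverse:
  assumes z: "z \<noteq> 0" and nz: "Theta z (q ^ 3) \<noteq> 0" "Theta (q * z) (q ^ 3) \<noteq> 0" "Theta (q ^ 2 * z) (q ^ 3) \<noteq> 0"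
    "Theta z q \<noteq> 0" "Theta (q * z ^ 3) (q ^ 3) \<noteq> 0"
  shows "z^4 * (Theta (z^2) (q^3) * Theta (q^6 * z^6) (q^9) / Theta z (q^3))
       + z^3 * (Theta (q^2 * z^2) (q^3) * Theta (q^3 * z^6) (q^9) / Theta (q * z) (q^3))
       - q * (Theta (q * z^2) (q^3) * Theta (z^6) (q^9) / Theta (q^2 * z) (q^3))
       = z^3 * qpoch_inf q q * qpoch_inf (q^3) (q^3) * Theta (z^3) q
         / (Theta z q * Theta (q * z^3) (q^3))" (is "?L = ?R")
proof -
  have q3: "0 < norm (q ^ 3)" "norm (q ^ 3) < 1" by (rule norm_power_nome[OF q]; simp)+
  have q9: "0 < norm (q ^ 9)" "norm (q ^ 9) < 1" by (rule norm_power_nome[OF q]; simp)+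
  note inv = Theta_inverse_power[OF q3 z, of 1, unfolded power_one_right] Theta_inverse_power[OF q3 z, of 2]
    Theta_inverse_power[OF q9 z, of 6] Theta_inverse_power[OF q z, of 1, unfolded power_one_right]
    Theta_inverse_power[OF q z, of 3]
  have reflect: "Theta (q * (1 / z) ^ k) (q ^ 3) = Theta (q ^ 2 * z ^ k) (q ^ 3)"
    "Theta (q ^ 2 * (1 / z) ^ k) (q ^ 3) = Theta (q * z ^ k) (q ^ 3)"
    "Theta (q ^ 3 * (1 / z) ^ k) (q ^ 9) = Theta (q ^ 6 * z ^ k) (q ^ 9)"
    "Theta (q ^ 6 * (1 / z) ^ k) (q ^ 9) = Theta (q ^ 3 * z ^ k) (q ^ 9)" for k
    using Theta_reflect_power[OF q z, of 3 1 2 k] Theta_reflect_power[OF q z, of 3 2 1 k]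
      Theta_reflect_power[OF q z, of 9 3 6 k] Theta_reflect_power[OF q z, of 9 6 3 k] by simp_all
  have one: "1 / z \<noteq> 0" using z by simp
  have "1 / z * ((- Theta (z^2) (q^3) / z^2) * Theta (q^6 * z^6) (q^9) / (- Theta z (q^3) / z))
       + q * (Theta (q * z^2) (q^3) * (- Theta (z^6) (q^9) / z^6) / Theta (q^2 * z) (q^3))
       + (1 / z)^3 * (Theta (q^2 * z^2) (q^3) * Theta (q^3 * z^6) (q^9) / Theta (q * z) (q^3))
       = 1 / z * qpoch_inf q q * qpoch_inf (q^3) (q^3) * (- Theta (z^3) q / z^3)
         / ((- Theta z q / z) * Theta (q * z^3) (q^3))"
    by (rule cubic_identity[OF one, unfolded inv reflect reflect[of 1, unfolded power_one_right]])
       (use nz z in simp_all)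
  hence "z ^ 6 * (1 / z * ((- Theta (z^2) (q^3) / z^2) * Theta (q^6 * z^6) (q^9) / (- Theta z (q^3) / z))
       + q * (Theta (q * z^2) (q^3) * (- Theta (z^6) (q^9) / z^6) / Theta (q^2 * z) (q^3))
       + (1 / z)^3 * (Theta (q^2 * z^2) (q^3) * Theta (q^3 * z^6) (q^9) / Theta (q * z) (q^3)))
       = z ^ 6 * (1 / z * qpoch_inf q q * qpoch_inf (q^3) (q^3) * (- Theta (z^3) q / z^3)
         / ((- Theta z q / z) * Theta (q * z^3) (q^3)))"
    by (rule arg_cong)
  moreover have "z ^ 6 * (1 / z * ((- Theta (z^2) (q^3) / z^2) * Theta (q^6 * z^6) (q^9) / (- Theta z (q^3) / z))
       + q * (Theta (q * z^2) (q^3) * (- Theta (z^6) (q^9) / z^6) / Theta (q^2 * z) (q^3))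
       + (1 / z)^3 * (Theta (q^2 * z^2) (q^3) * Theta (q^3 * z^6) (q^9) / Theta (q * z) (q^3))) = ?L"
    by (rule inverse_substitution_in_cubic(1)[OF z])
  moreover have "z ^ 6 * (1 / z * qpoch_inf q q * qpoch_inf (q^3) (q^3) * (- Theta (z^3) q / z^3)
         / ((- Theta z q / z) * Theta (q * z^3) (q^3))) = ?R"
    by (rule inverse_substitution_in_cubic(2)[OF z])
  ultimately show ?thesis by simp
qed

lemma cubic_identity_dual_inverse:
  assumes u: "u \<noteq> 0" and nz: "Theta (u^2) (q ^ 3) \<noteq> 0" "Theta (q * u^2) (q ^ 3) \<noteq> 0" "Theta (q ^ 2 * u^2) (q ^ 3) \<noteq> 0"
    "Theta u q \<noteq> 0" "Theta (q * u ^ 3) (q ^ 3) \<noteq> 0"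
  shows "u^2 * (Theta (u^4) (q^3) * Theta (q^6 * u^3) (q^9) / Theta (u^2) (q^3))
       + u^3 * (Theta (q^2 * u^4) (q^3) * Theta (q^3 * u^3) (q^9) / Theta (q * u^2) (q^3))
       - q * (Theta (q * u^4) (q^3) * Theta (u^3) (q^9) / Theta (q^2 * u^2) (q^3))
       = u^2 * qpoch_inf q q * qpoch_inf (q^3) (q^3) * Theta (u^3) q
         / (Theta u q * Theta (q * u^3) (q^3))" (is "?L = ?R")
proof -
  have q3: "0 < norm (q ^ 3)" "norm (q ^ 3) < 1" by (rule norm_power_nome[OF q]; simp)+
  have q9: "0 < norm (q ^ 9)" "norm (q ^ 9) < 1" by (rule norm_power_nome[OF q]; simp)+
  note inv = Theta_inverse_power[OF q3 u, of 2] Theta_inverse_power[OF q3 u, of 4]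
    Theta_inverse_power[OF q9 u, of 3] Theta_inverse_power[OF q u, of 1, unfolded power_one_right]
    Theta_inverse_power[OF q u, of 3]
  have reflect: "Theta (q * (1 / u) ^ k) (q ^ 3) = Theta (q ^ 2 * u ^ k) (q ^ 3)"
    "Theta (q ^ 2 * (1 / u) ^ k) (q ^ 3) = Theta (q * u ^ k) (q ^ 3)"
    "Theta (q ^ 3 * (1 / u) ^ k) (q ^ 9) = Theta (q ^ 6 * u ^ k) (q ^ 9)"
    "Theta (q ^ 6 * (1 / u) ^ k) (q ^ 9) = Theta (q ^ 3 * u ^ k) (q ^ 9)" for k
    using Theta_reflect_power[OF q u, of 3 1 2 k] Theta_reflect_power[OF q u, of 3 2 1 k]
      Theta_reflect_power[OF q u, of 9 3 6 k] Theta_reflect_power[OF q u, of 9 6 3 k] by simp_all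
  have one: "1 / u \<noteq> 0" using u by simp
  have "(- Theta (u^4) (q^3) / u^4) * Theta (q^6 * u^3) (q^9) / (- Theta (u^2) (q^3) / u^2)
       + 1 / u * q * (Theta (q * u^4) (q^3) * (- Theta (u^3) (q^9) / u^3) / Theta (q^2 * u^2) (q^3))
       + 1 / u * (Theta (q^2 * u^4) (q^3) * Theta (q^3 * u^3) (q^9) / Theta (q * u^2) (q^3))
       = qpoch_inf q q * qpoch_inf (q^3) (q^3)
         / ((- Theta u q / u) * Theta (q * u^3) (q^3)) * (- Theta (u^3) q / u^3)"
    by (rule cubic_identity_dual[OF one, unfolded inv reflect reflect[of 1, unfolded power_one_right]])
       (use nz u in simp_all)
  hence "u ^ 4 * ((- Theta (u^4) (q^3) / u^4) * Theta (q^6 * u^3) (q^9) / (- Theta (u^2) (q^3) / u^2)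
       + 1 / u * q * (Theta (q * u^4) (q^3) * (- Theta (u^3) (q^9) / u^3) / Theta (q^2 * u^2) (q^3))
       + 1 / u * (Theta (q^2 * u^4) (q^3) * Theta (q^3 * u^3) (q^9) / Theta (q * u^2) (q^3)))
       = u ^ 4 * (qpoch_inf q q * qpoch_inf (q^3) (q^3)
         / ((- Theta u q / u) * Theta (q * u^3) (q^3)) * (- Theta (u^3) q / u^3))"
    by (rule arg_cong)
  moreover have "u ^ 4 * ((- Theta (u^4) (q^3) / u^4) * Theta (q^6 * u^3) (q^9) / (- Theta (u^2) (q^3) / u^2)
       + 1 / u * q * (Theta (q * u^4) (q^3) * (- Theta (u^3) (q^9) / u^3) / Theta (q^2 * u^2) (q^3))
       + 1 / u * (Theta (q^2 * u^4) (q^3) * Theta (q^3 * u^3) (q^9) / Theta (q * u^2) (q^3))) = ?L"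
    by (rule inverse_substitution_in_cubic_dual(1)[OF u])
  moreover have "u ^ 4 * (qpoch_inf q q * qpoch_inf (q^3) (q^3)
         / ((- Theta u q / u) * Theta (q * u^3) (q^3)) * (- Theta (u^3) q / u^3)) = ?R"
    by (rule inverse_substitution_in_cubic_dual(2)[OF u])
  ultimately show ?thesis by simp
qed

text \<open>
  The three denominators multiply to \<open>Theta z (q ^ 2)\<close> up to a constant factor, which cancels the
  corresponding factor of \<open>sextic_theta_product\<close>.
\<close>
lemma sextic_identity:
  assumes z: "z \<noteq> 0" and nz: "Theta z (q ^ 6) \<noteq> 0" "Theta (q ^ 2 * z) (q ^ 6) \<noteq> 0" "Theta (q ^ 4 * z) (q ^ 6) \<noteq> 0"
  shows "q * (Theta (q^3 * z^2) (q^6) * Theta (z^6) (q^18) / Theta z (q^6))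
       + z^3 * (Theta (q * z^2) (q^6) * Theta (q^12 * z^6) (q^18) / Theta (q^2 * z) (q^6))
       + z^2 * (Theta (q^5 * z^2) (q^6) * Theta (q^6 * z^6) (q^18) / Theta (q^4 * z) (q^6))
       = z^2 * ((qpoch_inf (q^2) (q^2))^2 * Theta (q^3) (q^18) * Theta (- z) q / qpoch_inf q q)
         * (Theta (q^3 * z^3) (q^6) / (qpoch_inf (q^6) (q^6))^3)" (is "?L = ?R")
proof -
  have q2: "0 < norm (q ^ 2)" "norm (q ^ 2) < 1" by (rule norm_power_nome[OF q]; simp)+
  have q6: "0 < norm (q ^ 6)" "norm (q ^ 6) < 1" by (rule norm_power_nome[OF q]; simp)+
  define p p2 p6 where "p = qpoch_inf q q" and "p2 = qpoch_inf (q ^ 2) (q ^ 2)" and "p6 = qpoch_inf (q ^ 6) (q ^ 6)"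
  have p0: "p \<noteq> 0" "p2 \<noteq> 0" "p6 \<noteq> 0"
    unfolding p_def p2_def p6_def using q q2 q6 by (auto intro!: qpoch_inf_self_nonzero)
  define T where "T = Theta z (q ^ 6) * Theta (q ^ 2 * z) (q ^ 6) * Theta (q ^ 4 * z) (q ^ 6)"
  have T0: "T \<noteq> 0" using nz by (simp add: T_def)
  have "?L * T = sextic_theta_form q z"
    using nz by (simp add: T_def sextic_theta_form_def ring_distribs mult_ac)
  moreover have "p * sextic_theta_form q z = p2 * Theta (q ^ 3) (q ^ 18) * sextic_theta_product q z"
    using sextic_theta_form_eq_product[OF q z] by (simp add: p_def p2_def)
  moreover have "p6 ^ 3 * sextic_theta_product q z = z ^ 2 * (p2 * T) * Theta (- z) q * Theta (q ^ 3 * z ^ 3) (q ^ 6)"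
  proof -
    have "Theta z (q ^ 2) * p6 ^ 3 = p2 * T"
      using Theta_triplication_nome[OF q2 z] by (simp add: p2_def p6_def T_def flip: power_mult)
    moreover have "p6 ^ 3 * sextic_theta_product q z
        = z ^ 2 * (Theta z (q ^ 2) * p6 ^ 3) * Theta (- z) q * Theta (q ^ 3 * z ^ 3) (q ^ 6)"
      by (simp add: sextic_theta_product_def mult_ac)
    ultimately show ?thesis by simp
  qed
  moreover have "(p * p6 ^ 3 * ?L) * T = p6 ^ 3 * (p * (?L * T))" by (simp only: mult_ac)
  moreover have "p6 ^ 3 * (p2 * Theta (q ^ 3) (q ^ 18) * sextic_theta_product q z)
      = p2 * Theta (q ^ 3) (q ^ 18) * (p6 ^ 3 * sextic_theta_product q z)" by (simp only: mult_ac)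
  moreover have "p2 * Theta (q ^ 3) (q ^ 18) * (z ^ 2 * (p2 * T) * Theta (- z) q * Theta (q ^ 3 * z ^ 3) (q ^ 6))
      = (z ^ 2 * p2 ^ 2 * Theta (q ^ 3) (q ^ 18) * Theta (- z) q * Theta (q ^ 3 * z ^ 3) (q ^ 6)) * T"
    by (simp only: power2_eq_square mult_ac)
  ultimately have "(p * p6 ^ 3 * ?L) * T
      = (z ^ 2 * p2 ^ 2 * Theta (q ^ 3) (q ^ 18) * Theta (- z) q * Theta (q ^ 3 * z ^ 3) (q ^ 6)) * T"
    by (simp only:)
  hence "p * p6 ^ 3 * ?L = z ^ 2 * p2 ^ 2 * Theta (q ^ 3) (q ^ 18) * Theta (- z) q * Theta (q ^ 3 * z ^ 3) (q ^ 6)"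
    unfolding mult_cancel_right using T0 by blast
  hence "?L = z ^ 2 * p2 ^ 2 * Theta (q ^ 3) (q ^ 18) * Theta (- z) q * Theta (q ^ 3 * z ^ 3) (q ^ 6) / (p * p6 ^ 3)"
    using p0 by (simp add: eq_divide_eq mult_ac)
  also have "\<dots> = ?R" by (simp add: p_def p2_def p6_def)
  finally show ?thesis .
qed

end

theorem theorem9p1:
  fixes q z u :: complex
  assumes "0 < norm q" and "norm q < 1" and "z \<noteq> 0" and "u \<noteq> 0"
  shows
    "(Theta z (q^3) \<noteq> 0 \<and> Theta (q * z) (q^3) \<noteq> 0 \<and> Theta (q^2 * z) (q^3) \<noteq> 0 \<and>
     Theta z q \<noteq> 0 \<and> Theta (q^2 * z^3) (q^3) \<noteq> 0 \<longrightarrow>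
       z * (Theta (z^2) (q^3) * Theta (q^3 * z^6) (q^9) / Theta z (q^3))
       + q * (Theta (q^2 * z^2) (q^3) * Theta (z^6) (q^9) / Theta (q * z) (q^3))
       + z^3 * (Theta (q * z^2) (q^3) * Theta (q^6 * z^6) (q^9) / Theta (q^2 * z) (q^3))
       = z * qpoch_inf q q * qpoch_inf (q^3) (q^3) * Theta (z^3) q
         / (Theta z q * Theta (q^2 * z^3) (q^3))) \<and>
     (Theta z (q^3) \<noteq> 0 \<and> Theta (q * z) (q^3) \<noteq> 0 \<and> Theta (q^2 * z) (q^3) \<noteq> 0 \<and>
     Theta z q \<noteq> 0 \<and> Theta (q * z^3) (q^3) \<noteq> 0 \<longrightarrow>
       z^4 * (Theta (z^2) (q^3) * Theta (q^6 * z^6) (q^9) / Theta z (q^3))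
       + z^3 * (Theta (q^2 * z^2) (q^3) * Theta (q^3 * z^6) (q^9) / Theta (q * z) (q^3))
       - q * (Theta (q * z^2) (q^3) * Theta (z^6) (q^9) / Theta (q^2 * z) (q^3))
       = z^3 * qpoch_inf q q * qpoch_inf (q^3) (q^3) * Theta (z^3) q
         / (Theta z q * Theta (q * z^3) (q^3))) \<and>
     (Theta (u^2) (q^3) \<noteq> 0 \<and> Theta (q * u^2) (q^3) \<noteq> 0 \<and> Theta (q^2 * u^2) (q^3) \<noteq> 0 \<and>
     Theta u q \<noteq> 0 \<and> Theta (q^2 * u^3) (q^3) \<noteq> 0 \<longrightarrow>
       Theta (u^4) (q^3) * Theta (q^3 * u^3) (q^9) / Theta (u^2) (q^3)
       + u * q * (Theta (q^2 * u^4) (q^3) * Theta (u^3) (q^9) / Theta (q * u^2) (q^3))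
       + u * (Theta (q * u^4) (q^3) * Theta (q^6 * u^3) (q^9) / Theta (q^2 * u^2) (q^3))
       = qpoch_inf q q * qpoch_inf (q^3) (q^3)
         / (Theta u q * Theta (q^2 * u^3) (q^3)) * Theta (u^3) q) \<and>
     (Theta (u^2) (q^3) \<noteq> 0 \<and> Theta (q * u^2) (q^3) \<noteq> 0 \<and> Theta (q^2 * u^2) (q^3) \<noteq> 0 \<and>
     Theta u q \<noteq> 0 \<and> Theta (q * u^3) (q^3) \<noteq> 0 \<longrightarrow>
       u^2 * (Theta (u^4) (q^3) * Theta (q^6 * u^3) (q^9) / Theta (u^2) (q^3))
       + u^3 * (Theta (q^2 * u^4) (q^3) * Theta (q^3 * u^3) (q^9) / Theta (q * u^2) (q^3))
       - q * (Theta (q * u^4) (q^3) * Theta (u^3) (q^9) / Theta (q^2 * u^2) (q^3))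
       = u^2 * qpoch_inf q q * qpoch_inf (q^3) (q^3) * Theta (u^3) q
         / (Theta u q * Theta (q * u^3) (q^3))) \<and>
     (Theta z (q^6) \<noteq> 0 \<and> Theta (q^2 * z) (q^6) \<noteq> 0 \<and> Theta (q^4 * z) (q^6) \<noteq> 0 \<longrightarrow>
       q * (Theta (q^3 * z^2) (q^6) * Theta (z^6) (q^18) / Theta z (q^6))
       + z^3 * (Theta (q * z^2) (q^6) * Theta (q^12 * z^6) (q^18) / Theta (q^2 * z) (q^6))
       + z^2 * (Theta (q^5 * z^2) (q^6) * Theta (q^6 * z^6) (q^18) / Theta (q^4 * z) (q^6))
       = z^2 * ((qpoch_inf (q^2) (q^2))^2 * Theta (q^3) (q^18) * Theta (- z) q / qpoch_inf q q)
         * (Theta (q^3 * z^3) (q^6) / (qpoch_inf (q^6) (q^6))^3))"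
  by (intro conjI impI,
      elim conjE, rule cubic_identity[OF assms(1-3)], assumption+,
      elim conjE, rule cubic_identity_inverse[OF assms(1-3)], assumption+,
      elim conjE, rule cubic_identity_dual[OF assms(1,2,4)], assumption+,
      elim conjE, rule cubic_identity_dual_inverse[OF assms(1,2,4)], assumption+,
      elim conjE, rule sextic_identity[OF assms(1-3)], assumption+)

end
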